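(* Let $k,n\in\mathbb{N}$ and let $T$ be a completely non-unitary contraction on a separable infinite-dimensional complex Hilbert space $\mathcal{H}$ with $\dim\mathcal{D}_T=n$ and $\dim(\mathcal{D}_{T^*}\ominus\mathcal{D}_T)=k$. Let $F_1\in\mathcal{B}(\mathcal{H})$ be defined by $F_1x=Tx$ for $x\in\mathcal{D}_T$ and $F_1x=0$ for $x\in\mathcal{D}_T^\perp$. Then $T$ is quasinormal if and only if there exists an orthonormal basis $\{e_m\}_{m\ge1}$ of $\mathcal{H}$ such that, with $S_k$ the operator $S_ke_m=e_{m+k}$ ($m\ge1$), $P_n$ the orthogonal projection onto $\operatorname{span}\{e_1,\ldots,e_n\}$ and $F=F_1-S_kP_n$, one has $T=S_k+F$ and the following conditions hold: (1) $\operatorname{rank}(P_n-F_1^*F_1)=n$; (2) $F_1(I-P_n)=(I-P_n)F_1=0$; (3) $\|F_1^*x\|=\|F_1x\|$ for all $x\in\mathcal{H}$; (4) $\|F_1^rx\|<\|P_nx\|$ for all $r\in\mathbb{N}$ and all $x\in\mathcal{H}$ with $P_nx\ne0$.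
   Context: A contraction $T$ is completely non-unitary (c.n.u.) if it has no nonzero reducing subspace on which it is unitary. Its defect spaces are $\mathcal{D}_T=\overline{\operatorname{ran}}(I-T^*T)^{1/2}$ and $\mathcal{D}_{T^*}=\overline{\operatorname{ran}}(I-TT^* )^{1/2}$; $\mathcal{D}_{T^*}\ominus\mathcal{D}_T=\mathcal{D}_{T^*}\cap\mathcal{D}_T^\perp$. $\mathbb{N}=\{1,2,\ldots\}$. An operator $T$ is quasinormal if $T(T^*T)=(T^*T)T$. *)

theory Defs
  imports "HOL-Analysis.Analysis"
begin

section \<open>Complex Hilbert spaces\<close>

class complex_vector = real_vector +
  fixes scaleC :: "complex \<Rightarrow> 'a \<Rightarrow> 'a"  (infixr \<open>*\<^sub>C\<close> 75)
  assumes scaleC_add_right: "c *\<^sub>C (x + y) = c *\<^sub>C x + c *\<^sub>C y"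
    and scaleC_add_left: "(c + d) *\<^sub>C x = c *\<^sub>C x + d *\<^sub>C x"
    and scaleC_scaleC: "c *\<^sub>C d *\<^sub>C x = (c * d) *\<^sub>C x"
    and scaleC_one: "1 *\<^sub>C x = x"
    and scaleC_of_real: "complex_of_real r *\<^sub>C x = r *\<^sub>R x"

global_interpretation complex_vector:
  vector_space "scaleC :: complex \<Rightarrow> 'a \<Rightarrow> 'a::complex_vector"
  defines csubspace = complex_vector.subspace
    and cspan = complex_vector.span
    and cdim = complex_vector.dim
  by unfold_locales (rule scaleC_add_right scaleC_add_left scaleC_scaleC scaleC_one)+

text \<open>
  The inner product is linear in the first argument. Positive definiteness is contained in
  the last axiom, the norm of a real normed space being definite.
\<close>

class complex_inner = complex_vector + real_normed_vector +
  fixes cinner :: "'a \<Rightarrow> 'a \<Rightarrow> complex"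
  assumes cinner_commute: "cinner x y = cnj (cinner y x)"
    and cinner_add_left: "cinner (x + y) z = cinner x z + cinner y z"
    and cinner_scaleC_left: "cinner (c *\<^sub>C x) y = c * cinner x y"
    and cinner_self: "cinner x x = complex_of_real ((norm x)\<^sup>2)"

class chilbert_space = complex_inner + complete_space

definition orth_compl :: "'a::complex_inner set \<Rightarrow> 'a set" where
  "orth_compl M = {x. \<forall>y\<in>M. cinner x y = 0}"

definition orth_proj :: "'a::complex_inner set \<Rightarrow> 'a \<Rightarrow> 'a" where
  "orth_proj M x = (THE y. y \<in> M \<and> x - y \<in> orth_compl M)"

text \<open>The members of the family are indexed by the positive integers; \<open>e 0\<close> is irrelevant.\<close>

definition orthonormal_basis :: "(nat \<Rightarrow> 'a::complex_inner) \<Rightarrow> bool" where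
  "orthonormal_basis e \<longleftrightarrow>
     (\<forall>i\<ge>1. \<forall>j\<ge>1. cinner (e i) (e j) = (if i = j then 1 else 0)) \<and>
     closure (cspan (e ` {1..})) = UNIV"


section \<open>Bounded operators\<close>

definition bounded_clinear :: "('a::complex_inner \<Rightarrow> 'a) \<Rightarrow> bool" where
  "bounded_clinear A \<longleftrightarrow> bounded_linear A \<and> (\<forall>c x. A (c *\<^sub>C x) = c *\<^sub>C A x)"

text \<open>As for \<^const>\<open>adjoint\<close>, the choice is from at most one candidate.\<close>

definition cadjoint :: "('a::complex_inner \<Rightarrow> 'a) \<Rightarrow> 'a \<Rightarrow> 'a" where
  "cadjoint A = (SOME B. \<forall>x y. cinner (A x) y = cinner x (B y))"

definition positive_op :: "('a::complex_inner \<Rightarrow> 'a) \<Rightarrow> bool" where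
  "positive_op A \<longleftrightarrow> bounded_clinear A \<and> (\<forall>x. cinner (A x) x \<in> \<real>\<^sub>\<ge>\<^sub>0)"

text \<open>A positive operator on a Hilbert space has exactly one positive square root.\<close>

definition sqrt_op :: "('a::complex_inner \<Rightarrow> 'a) \<Rightarrow> 'a \<Rightarrow> 'a" where
  "sqrt_op A = (SOME B. positive_op B \<and> B \<circ> B = A)"

definition contraction :: "('a::complex_inner \<Rightarrow> 'a) \<Rightarrow> bool" where
  "contraction T \<longleftrightarrow> bounded_clinear T \<and> (\<forall>x. norm (T x) \<le> norm x)"

definition reducing_subspace :: "('a::complex_inner \<Rightarrow> 'a) \<Rightarrow> 'a set \<Rightarrow> bool" where
  "reducing_subspace T M \<longleftrightarrow>
     csubspace M \<and> closed M \<and> T ` M \<subseteq> M \<and> T ` orth_compl M \<subseteq> orth_compl M"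

definition unitary_on :: "'a::complex_inner set \<Rightarrow> ('a \<Rightarrow> 'a) \<Rightarrow> bool" where
  "unitary_on M T \<longleftrightarrow> T ` M = M \<and> (\<forall>x\<in>M. \<forall>y\<in>M. cinner (T x) (T y) = cinner x y)"

definition completely_non_unitary :: "('a::complex_inner \<Rightarrow> 'a) \<Rightarrow> bool" where
  "completely_non_unitary T \<longleftrightarrow>
     \<not> (\<exists>M. reducing_subspace T M \<and> M \<noteq> {0} \<and> unitary_on M T)"

text \<open>
  The space \<open>D\<^sub>T\<close>. As \<open>T\<^sup>*\<^sup>* = T\<close>, the space \<open>D\<^sub>T\<^sub>*\<close> is \<open>defect_space (cadjoint T)\<close>.
\<close>

definition defect_space :: "('a::complex_inner \<Rightarrow> 'a) \<Rightarrow> 'a set" where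
  "defect_space T = closure (range (sqrt_op (\<lambda>x. x - cadjoint T (T x))))"

definition quasinormal :: "('a::complex_inner \<Rightarrow> 'a) \<Rightarrow> bool" where
  "quasinormal T \<longleftrightarrow> T \<circ> (cadjoint T \<circ> T) = (cadjoint T \<circ> T) \<circ> T"

text \<open>
  The dimension \<^const>\<open>cdim\<close> is \<open>0\<close> on infinite-dimensional spaces, so
  \<open>op_rank A = n\<close> means finite rank only for \<open>n > 0\<close>.
\<close>

definition op_rank :: "('a::complex_inner \<Rightarrow> 'a) \<Rightarrow> nat" where
  "op_rank A = cdim (range A)"

end

theory Submission
  imports Defs
begin

text \<open>
  If \<open>T\<close> is quasinormal, then \<open>D\<^sub>T\<^sup>\<bottom> = ker (I - T\<^sup>*T)\<close> reduces \<open>T\<close>. On the finite-dimensional space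
  \<open>D\<^sub>T\<close>, quasinormality becomes normality. On the complement, \<open>T\<close> is an isometry without unitary
  part, and the kernel of its adjoint is \<open>D\<^sub>T\<^sub>* \<ominus> D\<^sub>T\<close>, so by the Wold decomposition it is a
  shift of multiplicity \<open>k\<close>: an orthonormal basis of \<open>D\<^sub>T\<close> followed by one of the wandering
  subspace and its images under the powers of \<open>T\<close> is the required basis. Conversely, \<open>T = S\<^sub>k + F\<close>
  is the direct sum of \<open>F\<^sub>1\<close> on the range of \<open>P\<^sub>n\<close> and the isometry \<open>S\<^sub>k\<close> on its complement, and
  condition (3) says that \<open>F\<^sub>1\<close> is normal.
\<close>

subsection \<open>The inner product\<close>

text \<open>Quasinormality and its adjoint say that T and T* both commute with T*T, so both preserve
  the space of vectors fixed by T*T; this is why that space reduces T. The defect spaces are given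
  through a square root, but a positive root has the same kernel as its square. Once a positive root
  is known to exist, which a norm-convergent iteration provides, every defect space becomes the
  complement of an explicit kernel.

  Completeness of the basis is obtained indirectly: the vectors orthogonal to all its members form a
  reducing subspace on which T is unitary, and complete non-unitarity makes it zero.

  The operator S must shift the whole basis, including the part spanning D, where T need not act as
  a shift. Subtracting S P inside F cancels exactly this artificial part, leaving T = S (I - P) +
  \<open>F\<^sub>1\<close>. Finite dimension of D enters through "injective implies surjective",
  once for normality and once for the rank in condition (1).\<close>

lemma cinner_add_right: "cinner x (y + z) = cinner x y + cinner x (z :: 'a::complex_inner)"
  by (metis cinner_commute cinner_add_left complex_cnj_add)

lemma cinner_scaleC_right: "cinner x (c *\<^sub>C y) = cnj c * cinner x (y :: 'a::complex_inner)"
  by (metis cinner_commute cinner_scaleC_left complex_cnj_mult)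

lemma cinner_scaleR_left: "cinner (r *\<^sub>R x) y = r *\<^sub>R cinner x (y :: 'a::complex_inner)"
  by (metis cinner_scaleC_left scaleC_of_real scaleR_conv_of_real)

lemma cinner_scaleR_right: "cinner x (r *\<^sub>R y) = r *\<^sub>R cinner x (y :: 'a::complex_inner)"
  by (metis cinner_scaleC_right scaleC_of_real scaleR_conv_of_real complex_cnj_complex_of_real)

text \<open>The class provides only a real norm, so homogeneity under complex scalars has to come
  from the axiom \<open>cinner_self\<close>.\<close>

lemma norm_scaleC: "norm (c *\<^sub>C x) = cmod c * norm (x :: 'a::complex_inner)"
proof -
  have "complex_of_real ((norm (c *\<^sub>C x))\<^sup>2) = c * cnj c * complex_of_real ((norm x)\<^sup>2)"
    by (simp only: cinner_scaleC_left cinner_scaleC_right mult_ac flip: cinner_self)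
  also have "\<dots> = complex_of_real ((cmod c * norm x)\<^sup>2)"
    by (simp only: power_mult_distrib of_real_mult complex_norm_square)
  finally have "(norm (c *\<^sub>C x))\<^sup>2 = (cmod c * norm x)\<^sup>2"
    by (simp only: of_real_eq_iff)
  then show ?thesis
    by (simp add: power2_eq_iff_nonneg)
qed

lemma norm_add_sq:
  "(norm (x + y))\<^sup>2 = (norm x)\<^sup>2 + (norm y)\<^sup>2 + 2 * Re (cinner x (y :: 'a::complex_inner))"
proof -
  have "complex_of_real ((norm (x + y))\<^sup>2) = cinner x x + cinner y y + (cinner x y + cinner y x)"
    by (simp only: cinner_add_left cinner_add_right add_ac flip: cinner_self)
  also have "cinner x y + cinner y x = complex_of_real (2 * Re (cinner x y))"
    using cinner_commute[of y x] complex_add_cnj[of "cinner x y"] by simp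
  finally show ?thesis
    by (simp only: cinner_self flip: of_real_add) (simp only: of_real_eq_iff)
qed

lemma cinner_norm_le: "cmod (cinner x y) \<le> norm x * norm (y :: 'a::complex_inner)"
proof (cases "y = 0")
  case True
  have "cinner x 0 = 0"
    using cinner_scaleR_right[of x 0 0] by simp
  with True show ?thesis by simp
next
  case False
  \<comment> \<open>The minimiser of the norm of x + c y; that the minimum is nonnegative is the
    Cauchy-Schwarz inequality.\<close>
  define c where "c = - cinner x y / complex_of_real ((norm y)\<^sup>2)"
  have "Re (cinner x (c *\<^sub>C y)) = Re (cnj c * cinner x y)"
    by (simp add: cinner_scaleC_right)
  also have "cnj c * cinner x y = complex_of_real (- (cmod (cinner x y))\<^sup>2 / (norm y)\<^sup>2)"
    unfolding c_def by (simp add: complex_norm_square mult.commute del: of_real_power)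
  finally have re: "Re (cinner x (c *\<^sub>C y)) = - (cmod (cinner x y))\<^sup>2 / (norm y)\<^sup>2"
    by (metis Re_complex_of_real)
  have "(norm (c *\<^sub>C y))\<^sup>2 = (cmod (cinner x y))\<^sup>2 / (norm y)\<^sup>2"
    using False unfolding norm_scaleC c_def
    by (simp add: norm_divide norm_mult norm_power power_mult_distrib power_divide field_simps power2_eq_square)
  with re have "(norm (x + c *\<^sub>C y))\<^sup>2 = (norm x)\<^sup>2 - (cmod (cinner x y))\<^sup>2 / (norm y)\<^sup>2"
    unfolding norm_add_sq by simp
  then have "(cmod (cinner x y))\<^sup>2 / (norm y)\<^sup>2 \<le> (norm x)\<^sup>2"
    by (metis diff_ge_0_iff_ge zero_le_power2)
  then have "(cmod (cinner x y))\<^sup>2 \<le> (norm x * norm y)\<^sup>2"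
    using False by (simp add: divide_le_eq power_mult_distrib)
  then show ?thesis
    by (rule power2_le_imp_le) simp
qed

interpretation cinner: bounded_bilinear "cinner :: 'a::complex_inner \<Rightarrow> 'a \<Rightarrow> complex"
proof
  show "\<exists>K. \<forall>a b. cmod (cinner a b) \<le> norm (a :: 'a) * norm b * K"
    using cinner_norm_le by (metis mult.right_neutral)
qed (rule cinner_add_left cinner_add_right cinner_scaleR_left cinner_scaleR_right)+

lemma bounded_linear_scaleC: "bounded_linear (\<lambda>x :: 'a::complex_inner. c *\<^sub>C x)"
proof
  show "c *\<^sub>C r *\<^sub>R x = r *\<^sub>R c *\<^sub>C x" for r and x :: 'a
    by (metis scaleC_of_real scaleC_scaleC mult.commute)
  show "\<exists>K. \<forall>x :: 'a. norm (c *\<^sub>C x) \<le> norm x * K"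
    by (metis norm_scaleC mult.commute order_refl)
qed (rule scaleC_add_right)

lemma cinner_eq_zero_iff [simp]: "cinner x x = 0 \<longleftrightarrow> x = (0 :: 'a::complex_inner)"
  by (simp add: cinner_self)

lemma cinner_eq_0_commute: "cinner x y = 0 \<longleftrightarrow> cinner y (x :: 'a::complex_inner) = 0"
  by (metis cinner_commute complex_cnj_zero)

lemma cinner_eqI:
  assumes "\<And>z. cinner x z = cinner (y :: 'a::complex_inner) z"
  shows "x = y"
  using assms[of "x - y"] by (metis cinner.diff_left cinner_eq_zero_iff right_minus_eq)

lemma norm_diff_sq:
  "(norm (x - y))\<^sup>2 = (norm x)\<^sup>2 + (norm y)\<^sup>2 - 2 * Re (cinner x (y :: 'a::complex_inner))"
  using norm_add_sq[of x "- y"] by (simp add: cinner.minus_right)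

lemma parallelogram:
  "(norm (x + y))\<^sup>2 + (norm (x - y))\<^sup>2 = 2 * (norm x)\<^sup>2 + 2 * (norm (y :: 'a::complex_inner))\<^sup>2"
  by (simp add: norm_add_sq norm_diff_sq)

text \<open>Polarisation: x + y shows that h x y = - h y x, and x + i y that h x y = h y x. It turns
  facts about the diagonal, such as positivity or equality of norms, into operator
  identities.\<close>

lemma sesquilinear_zero_if_diagonal_zero:
  fixes h :: "'a::complex_vector \<Rightarrow> 'a \<Rightarrow> complex"
  assumes "\<And>x y z. h (x + y) z = h x z + h y z" and "\<And>x y z. h z (x + y) = h z x + h z y"
    and "\<And>x z c. h (c *\<^sub>C x) z = c * h x z" and "\<And>x z c. h z (c *\<^sub>C x) = cnj c * h z x"
    and diag: "\<And>x. h x x = 0"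
  shows "h x y = 0"
proof -
  have "h x y + h y x = 0"
    using diag[of "x + y"] diag[of x] diag[of y] by (simp add: assms(1-4) add.commute)
  moreover have "- \<i> * h x y + \<i> * h y x = 0"
    using diag[of "x + \<i> *\<^sub>C y"] diag[of x] diag[of y] by (simp add: assms(1-4))
  ultimately show ?thesis
    by (auto simp: algebra_simps add_eq_0_iff)
qed

subsection \<open>Orthogonal complements and projections\<close>

lemma csubspaceD:
  assumes "csubspace M"
  shows "0 \<in> M" and "x \<in> M \<Longrightarrow> y \<in> M \<Longrightarrow> x + y \<in> M" and "x \<in> M \<Longrightarrow> c *\<^sub>C x \<in> M"
    and "x \<in> M \<Longrightarrow> y \<in> M \<Longrightarrow> x - y \<in> M" and "x \<in> M \<Longrightarrow> r *\<^sub>R x \<in> M"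
  using complex_vector.subspace_0[OF assms] complex_vector.subspace_add[OF assms]
    complex_vector.subspace_scale[OF assms] complex_vector.subspace_diff[OF assms]
    scaleC_of_real[of r x]
  by auto metis

lemma csubspace_orth_compl: "csubspace (orth_compl M)"
  by (rule complex_vector.subspaceI)
    (auto simp: orth_compl_def cinner.zero_left cinner_add_left cinner_scaleC_left)

lemma closed_orth_compl: "closed (orth_compl M)"
proof -
  have "orth_compl M = (\<Inter>y\<in>M. {x. cinner x y = 0})"
    by (auto simp: orth_compl_def)
  moreover have "closed {x. cinner x y = 0}" for y :: 'a
    by (intro closed_Collect_eq cinner.continuous_on continuous_intros)
  ultimately show ?thesis
    by auto
qed

lemma orth_compl_cspan: "orth_compl (cspan B) = orth_compl B"
proof
  show "orth_compl (cspan B) \<subseteq> orth_compl B"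
    using complex_vector.span_superset[of B] by (auto simp: orth_compl_def)
  show "orth_compl B \<subseteq> orth_compl (cspan B)"
  proof
    fix x assume x: "x \<in> orth_compl B"
    have "cspan B \<subseteq> orth_compl {x}"
      by (rule complex_vector.span_minimal)
        (use x csubspace_orth_compl[of "{x}"] in \<open>auto simp: orth_compl_def cinner_eq_0_commute\<close>)
    then show "x \<in> orth_compl (cspan B)"
      by (auto simp: orth_compl_def cinner_eq_0_commute)
  qed
qed

lemma csubspace_closure:
  assumes "csubspace (M :: 'a::complex_inner set)"
  shows "csubspace (closure M)"
proof (rule complex_vector.subspaceI)
  show "0 \<in> closure M"
    using csubspaceD(1)[OF assms] closure_subset by blast
next
  fix x y assume "x \<in> closure M" "y \<in> closure M"
  then obtain u v where "\<forall>n. u n \<in> M" "u \<longlonglongrightarrow> x" "\<forall>n. v n \<in> M" "v \<longlonglongrightarrow> y"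
    by (auto simp: closure_sequential)
  then have "\<forall>n. u n + v n \<in> M" "(\<lambda>n. u n + v n) \<longlonglongrightarrow> x + y"
    using csubspaceD(2)[OF assms] tendsto_add by auto
  then show "x + y \<in> closure M"
    by (auto simp: closure_sequential intro!: exI[of _ "\<lambda>n. u n + v n"])
next
  fix c x assume "x \<in> closure M"
  then obtain u where "\<forall>n. u n \<in> M" "u \<longlonglongrightarrow> x"
    by (auto simp: closure_sequential)
  then have "\<forall>n. c *\<^sub>C u n \<in> M" "(\<lambda>n. c *\<^sub>C u n) \<longlonglongrightarrow> c *\<^sub>C x"
    using csubspaceD(3)[OF assms] bounded_linear.tendsto[OF bounded_linear_scaleC] by auto
  then show "c *\<^sub>C x \<in> closure M"
    by (auto simp: closure_sequential intro!: exI[of _ "\<lambda>n. c *\<^sub>C u n"])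
qed

lemma exists_nearest_point:
  fixes M :: "'a::chilbert_space set"
  assumes M: "csubspace M" and cl: "closed M"
  obtains p where "p \<in> M" "\<And>y. y \<in> M \<Longrightarrow> norm (x - p) \<le> norm (x - y)"
proof -
  define d where "d = (INF y\<in>M. norm (x - y))"
  have bdd: "bdd_below ((\<lambda>y. norm (x - y)) ` M)"
    by (rule bdd_belowI[of _ 0]) auto
  have d_le: "d \<le> norm (x - y)" if "y \<in> M" for y
    unfolding d_def using bdd that by (rule cINF_lower)
  have d0: "0 \<le> d"
    unfolding d_def using csubspaceD(1)[OF M] by (intro cINF_greatest) auto
  have "\<exists>y\<in>M. norm (x - y) < d + 1 / Suc n" for n
    using cINF_less_iff[OF _ bdd, of "d + 1 / Suc n"] csubspaceD(1)[OF M]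
    unfolding d_def by auto
  then obtain y where y: "\<And>n. y n \<in> M" "\<And>n. norm (x - y n) < d + 1 / Suc n"
    by metis
  have lim: "(\<lambda>n. norm (x - y n)) \<longlonglongrightarrow> d"
  proof (rule tendsto_sandwich[where f = "\<lambda>_. d"])
    show "(\<lambda>n. d + 1 / real (Suc n)) \<longlonglongrightarrow> d"
      using tendsto_add[OF tendsto_const[of d] LIMSEQ_inverse_real_of_nat]
      by (simp add: inverse_eq_divide)
    show "\<forall>\<^sub>F n in sequentially. norm (x - y n) \<le> d + 1 / real (Suc n)"
      using y(2) by (intro always_eventually) (simp add: less_imp_le)
  qed (use y(1) d_le in auto)
  \<comment> \<open>The midpoint of two members of the sequence lies in M, so its distance to x is
    at least d; the parallelogram law converts this into a bound on their mutual distance.\<close>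
  have key: "(norm (y m - y n))\<^sup>2 \<le> 2 * (norm (x - y m))\<^sup>2 + 2 * (norm (x - y n))\<^sup>2 - 4 * d\<^sup>2" for m n
  proof -
    let ?z = "(1 / 2) *\<^sub>R (y m + y n)"
    have "?z \<in> M"
      using y(1) M by (intro csubspaceD)
    then have "d\<^sup>2 \<le> (norm (x - ?z))\<^sup>2"
      using d_le d0 by (intro power_mono) auto
    moreover have "(x - y m) + (x - y n) = 2 *\<^sub>R (x - ?z)"
      by (simp add: algebra_simps scaleR_2)
    then have "norm ((x - y m) + (x - y n)) = 2 * norm (x - ?z)"
      by (metis norm_scaleR abs_numeral)
    then have "(norm ((x - y m) + (x - y n)))\<^sup>2 = 4 * (norm (x - ?z))\<^sup>2"
      by (simp add: power_mult_distrib)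
    moreover have "norm ((x - y m) - (x - y n)) = norm (y m - y n)"
      by (simp add: norm_minus_commute)
    ultimately show ?thesis
      using parallelogram[of "x - y m" "x - y n"] by simp
  qed
  have "Cauchy y"
  proof (rule metric_CauchyI)
    fix e :: real assume e: "0 < e"
    have "(\<lambda>n. (norm (x - y n))\<^sup>2) \<longlonglongrightarrow> d\<^sup>2"
      by (intro tendsto_intros lim)
    then have "\<forall>\<^sub>F n in sequentially. (norm (x - y n))\<^sup>2 < d\<^sup>2 + e\<^sup>2 / 4"
      using e by (intro order_tendstoD) auto
    then obtain N where N: "\<And>n. n \<ge> N \<Longrightarrow> (norm (x - y n))\<^sup>2 < d\<^sup>2 + e\<^sup>2 / 4"
      by (auto simp: eventually_sequentially)
    have "dist (y m) (y n) < e" if "m \<ge> N" "n \<ge> N" for m n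
    proof -
      have "(norm (y m - y n))\<^sup>2 < e\<^sup>2"
        using key[of m n] N[OF that(1)] N[OF that(2)] by simp
      then show ?thesis
        using e by (simp add: dist_norm power_less_imp_less_base)
    qed
    then show "\<exists>N. \<forall>m\<ge>N. \<forall>n\<ge>N. dist (y m) (y n) < e"
      by blast
  qed
  then obtain p where p: "y \<longlonglongrightarrow> p"
    by (auto simp: Cauchy_convergent_iff convergent_def)
  have "p \<in> M"
    using cl y(1) p by (auto simp: closed_sequential_limits)
  moreover have "(\<lambda>n. norm (x - y n)) \<longlonglongrightarrow> norm (x - p)"
    by (intro tendsto_intros p)
  then have "norm (x - p) = d"
    using lim LIMSEQ_unique by blast
  ultimately show ?thesis
    using that d_le by blast
qed

lemma exists_orth_decomposition:
  fixes M :: "'a::chilbert_space set"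
  assumes M: "csubspace M" and cl: "closed M"
  obtains p where "p \<in> M" "x - p \<in> orth_compl M"
proof -
  obtain p where p: "p \<in> M" "\<And>y. y \<in> M \<Longrightarrow> norm (x - p) \<le> norm (x - y)"
    using exists_nearest_point[OF assms] by blast
  have "cinner (x - p) y = 0" if y: "y \<in> M" for y
  proof (cases "y = 0")
    case False
    define a where "a = cinner (x - p) y"
    \<comment> \<open>With this step length, t a y is the projection of x - p onto the line of y.
      Minimality at p gives 2 t |a|^2 \<le> t^2 |a|^2 |y|^2 = t |a|^2, which forces a = 0.\<close>
    define t where "t = 1 / (norm y)\<^sup>2"
    have t0: "0 < t"
      using False by (simp add: t_def)
    have "p + (complex_of_real t * a) *\<^sub>C y \<in> M"
      using p y M by (intro csubspaceD)
    then have "norm (x - p) \<le> norm (x - p - (complex_of_real t * a) *\<^sub>C y)"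
      using p(2) by (simp add: algebra_simps)
    then have "(norm (x - p))\<^sup>2 \<le> (norm (x - p - (complex_of_real t * a) *\<^sub>C y))\<^sup>2"
      by (intro power_mono) auto
    also have "\<dots> = (norm (x - p))\<^sup>2 + (t * cmod a * norm y)\<^sup>2
        - 2 * Re (cnj (complex_of_real t * a) * a)"
      unfolding norm_diff_sq cinner_scaleC_right norm_scaleC norm_mult a_def[symmetric]
      using t0 by simp
    also have "cnj (complex_of_real t * a) * a = complex_of_real (t * (cmod a)\<^sup>2)"
      by (simp add: complex_norm_square mult_ac del: of_real_power)
    finally have "2 * (t * (cmod a)\<^sup>2) \<le> (t * cmod a * norm y)\<^sup>2"
      by simp
    also have "\<dots> = t * (cmod a)\<^sup>2"
      using False by (simp add: t_def power_mult_distrib field_simps power2_eq_square)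
    finally have "t * (cmod a)\<^sup>2 \<le> 0"
      by simp
    with t0 have "(cmod a)\<^sup>2 \<le> 0"
      by (simp add: mult_le_0_iff)
    then show ?thesis
      by (simp add: a_def)
  qed (simp add: cinner.zero_right)
  with p that show ?thesis
    by (auto simp: orth_compl_def)
qed

lemma orth_compl_inter: "x \<in> M \<Longrightarrow> x \<in> orth_compl M \<Longrightarrow> x = 0"
  by (auto simp: orth_compl_def)

lemma orth_compl_orth_compl:
  fixes M :: "'a::chilbert_space set"
  assumes M: "csubspace M" and cl: "closed M"
  shows "orth_compl (orth_compl M) = M"
proof
  show "M \<subseteq> orth_compl (orth_compl M)"
    by (auto simp: orth_compl_def cinner_eq_0_commute)
  show "orth_compl (orth_compl M) \<subseteq> M"
  proof
    fix x assume x: "x \<in> orth_compl (orth_compl M)"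
    obtain p where p: "p \<in> M" "x - p \<in> orth_compl M"
      using exists_orth_decomposition[OF assms] by blast
    then have "x - p \<in> orth_compl (orth_compl M)"
      using x \<open>M \<subseteq> orth_compl (orth_compl M)\<close> csubspaceD(4)[OF csubspace_orth_compl] by blast
    with p(2) have "x - p = 0"
      by (rule orth_compl_inter)
    with p show "x \<in> M" by simp
  qed
qed

lemma orth_compl_closure: "orth_compl (closure M) = orth_compl M"
proof
  show "orth_compl (closure M) \<subseteq> orth_compl M"
    using closure_subset by (fastforce simp: orth_compl_def)
  show "orth_compl M \<subseteq> orth_compl (closure M)"
  proof
    fix x assume x: "x \<in> orth_compl M"
    have "closure M \<subseteq> orth_compl {x}"
      by (rule closure_minimal)
        (use x closed_orth_compl[of "{x}"] in \<open>auto simp: orth_compl_def cinner_eq_0_commute\<close>)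
    then show "x \<in> orth_compl (closure M)"
      by (auto simp: orth_compl_def cinner_eq_0_commute)
  qed
qed

lemma closure_eq_orth_compl_orth_compl:
  fixes M :: "'a::chilbert_space set"
  assumes "csubspace M"
  shows "closure M = orth_compl (orth_compl M)"
  using orth_compl_orth_compl[OF csubspace_closure[OF assms] closed_closure]
  by (simp add: orth_compl_closure)

lemma orth_proj_eqI:
  assumes M: "csubspace M" and "y \<in> M" and "x - y \<in> orth_compl M"
  shows "orth_proj M x = y"
  unfolding orth_proj_def
proof (rule the_equality)
  fix z assume z: "z \<in> M \<and> x - z \<in> orth_compl M"
  have "(x - y) - (x - z) \<in> orth_compl M"
    by (rule csubspaceD(4)[OF csubspace_orth_compl]) (use z assms in auto)
  moreover have "z - y \<in> M"
    by (rule csubspaceD(4)[OF M]) (use z assms in auto)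
  ultimately have "z - y = 0"
    by (intro orth_compl_inter) auto
  then show "z = y" by simp
qed (use assms in auto)

subsection \<open>Bounded operators and adjoints\<close>

lemma bounded_clinearD:
  assumes "bounded_clinear A"
  shows "bounded_linear A" and "A (x + y) = A x + A y" and "A (x - y) = A x - A y"
    and "A 0 = 0" and "A (c *\<^sub>C x) = c *\<^sub>C A x" and "A (sum f I) = (\<Sum>i\<in>I. A (f i))"
proof -
  show A: "bounded_linear A" and "A (c *\<^sub>C x) = c *\<^sub>C A x"
    using assms by (auto simp: bounded_clinear_def)
  interpret bounded_linear A by (rule A)
  show "A (x + y) = A x + A y" "A (x - y) = A x - A y" "A 0 = 0" "A (sum f I) = (\<Sum>i\<in>I. A (f i))"
    by (rule add diff zero sum)+
qed

lemma bounded_clinearI: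
  assumes "\<And>x y. A (x + y) = A x + A y" and "\<And>c x. A (c *\<^sub>C x) = c *\<^sub>C A x"
    and "\<And>x. norm (A x) \<le> norm x * K"
  shows "bounded_clinear A"
  unfolding bounded_clinear_def
proof
  show "bounded_linear A"
    by (rule bounded_linear_intro[of A K]) (use assms in \<open>auto simp flip: scaleC_of_real\<close>)
qed (use assms in auto)

lemma bounded_clinear_ident: "bounded_clinear (\<lambda>x. x)"
  by (rule bounded_clinearI[where K = 1]) auto

lemma bounded_clinear_compose:
  "bounded_clinear A \<Longrightarrow> bounded_clinear B \<Longrightarrow> bounded_clinear (\<lambda>x. A (B x))"
  by (auto simp: bounded_clinear_def intro: bounded_linear_compose)

lemma bounded_clinear_add:
  "bounded_clinear A \<Longrightarrow> bounded_clinear B \<Longrightarrow> bounded_clinear (\<lambda>x. A x + B x)"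
  by (auto simp: bounded_clinear_def intro: bounded_linear_add simp: scaleC_add_right)

lemma bounded_clinear_diff:
  "bounded_clinear A \<Longrightarrow> bounded_clinear B \<Longrightarrow> bounded_clinear (\<lambda>x. A x - B x)"
  by (auto simp: bounded_clinear_def intro: bounded_linear_sub simp: complex_vector.scale_right_diff_distrib)

lemma csubspace_ker:
  assumes "bounded_clinear A"
  shows "csubspace {x. A x = 0}"
  by (rule complex_vector.subspaceI) (auto simp: bounded_clinearD[OF assms])

lemma csubspace_range:
  assumes "bounded_clinear A" and "csubspace M"
  shows "csubspace (A ` M)"
proof (rule complex_vector.subspaceI)
  show "0 \<in> A ` M"
    using csubspaceD(1)[OF assms(2)] bounded_clinearD(4)[OF assms(1)] by force
  show "x + y \<in> A ` M" if "x \<in> A ` M" "y \<in> A ` M" for x y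
    using that csubspaceD(2)[OF assms(2)] bounded_clinearD(2)[OF assms(1), symmetric] by auto
  show "c *\<^sub>C x \<in> A ` M" if "x \<in> A ` M" for c x
    using that csubspaceD(3)[OF assms(2)] bounded_clinearD(5)[OF assms(1), symmetric] by auto
qed

lemma closed_ker:
  assumes "bounded_clinear A"
  shows "closed {x. A x = 0}"
  using bounded_clinearD(1)[OF assms]
  by (intro closed_Collect_eq continuous_intros linear_continuous_on)

section \<open>Riesz representation and adjoints\<close>

lemma Riesz_representation:
  fixes f :: "'a::chilbert_space \<Rightarrow> complex"
  assumes f: "bounded_linear f" and fC: "\<And>c x. f (c *\<^sub>C x) = c * f x"
  obtains z where "\<And>x. f x = cinner x z"
proof (cases "\<forall>x. f x = 0")
  case True
  then show ?thesis
    using that[of 0] by (simp add: cinner.zero_right)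
next
  case False
  interpret f: bounded_linear f by (rule f)
  let ?M = "{x. f x = 0}"
  have M: "csubspace ?M"
    by (rule complex_vector.subspaceI) (auto simp: f.zero f.add fC)
  have cl: "closed ?M"
    by (intro closed_Collect_eq continuous_intros f.continuous_on)
  obtain a where a: "f a \<noteq> 0" using False by blast
  obtain p where p: "p \<in> ?M" "a - p \<in> orth_compl ?M"
    using exists_orth_decomposition[OF M cl] by blast
  \<comment> \<open>This vector spans the complement of the kernel: x - (f x / f u) u is in the
    kernel, so pairing x with u recovers f x up to a factor. The conjugate in the representing
    vector compensates for conjugate linearity in the second argument.\<close>
  define u where "u = a - p"
  have fu: "f u \<noteq> 0" using a p by (simp add: u_def f.diff)
  then have u0: "cinner u u \<noteq> 0" using f.zero by auto
  have "f x = cinner x (cnj (f u / cinner u u) *\<^sub>C u)" for x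
  proof -
    have "x - (f x / f u) *\<^sub>C u \<in> ?M"
      using fu by (simp add: f.diff fC)
    then have "cinner (x - (f x / f u) *\<^sub>C u) u = 0"
      using p(2) unfolding u_def[symmetric] by (auto simp: orth_compl_def cinner_eq_0_commute)
    then have "cinner x u = (f x / f u) * cinner u u"
      by (simp add: cinner.diff_left cinner_scaleC_left)
    then show ?thesis
      using fu u0 by (simp add: cinner_scaleC_right)
  qed
  then show ?thesis by (rule that)
qed

text \<open>Riesz representation, applied at each y separately, supplies the witness for the
  \<open>SOME\<close> in \<open>cadjoint\<close>. All later properties of adjoints come from this
  identity.\<close>

lemma cinner_cadjoint_right:
  fixes A :: "'a::chilbert_space \<Rightarrow> 'a"
  assumes A: "bounded_clinear A"
  shows "cinner x (cadjoint A y) = cinner (A x) y"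
proof -
  have "\<exists>z. \<forall>x. cinner (A x) y = cinner x z" for y
  proof -
    have "bounded_linear (\<lambda>x. cinner (A x) y)"
      by (rule cinner.bounded_linear_left[THEN bounded_linear_compose]) (rule bounded_clinearD[OF A])
    from Riesz_representation[OF this] show ?thesis
      by (metis (no_types, lifting) bounded_clinearD(5)[OF A] cinner_scaleC_left)
  qed
  then have "\<exists>B. \<forall>x y. cinner (A x) y = cinner x (B y)"
    by metis
  then have "\<forall>x y. cinner (A x) y = cinner x (cadjoint A y)"
    unfolding cadjoint_def by (rule someI_ex)
  then show ?thesis by simp
qed

lemma cinner_cadjoint_left:
  fixes A :: "'a::chilbert_space \<Rightarrow> 'a"
  assumes "bounded_clinear A"
  shows "cinner (cadjoint A y) x = cinner y (A x)"
  by (metis assms cinner_cadjoint_right cinner_commute)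

lemma bounded_clinear_cadjoint:
  fixes A :: "'a::chilbert_space \<Rightarrow> 'a"
  assumes A: "bounded_clinear A"
  shows "bounded_clinear (cadjoint A)"
proof -
  obtain K where K: "K \<ge> 0" "\<And>x. norm (A x) \<le> norm x * K"
    using bounded_linear.nonneg_bounded[OF bounded_clinearD(1)[OF A]] by blast
  show ?thesis
  proof (rule bounded_clinearI[where K = K])
    fix x
    have "(norm (cadjoint A x))\<^sup>2 = cmod (cinner (A (cadjoint A x)) x)"
      by (simp add: cinner_self norm_power flip: cinner_cadjoint_right[OF A])
    also have "\<dots> \<le> norm (cadjoint A x) * (norm x * K)"
      using cinner_norm_le[of "A (cadjoint A x)" x]
        mult_right_mono[OF K(2)[of "cadjoint A x"] norm_ge_zero[of x]] by (simp add: mult_ac)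
    finally show "norm (cadjoint A x) \<le> norm x * K"
      using K(1) by (cases "cadjoint A x = 0") (auto simp: power2_eq_square)
  qed (rule cinner_eqI, simp add: cinner_cadjoint_left[OF A] cinner_add_left cinner_scaleC_left)+
qed

lemma cadjoint_eqI:
  fixes A :: "'a::chilbert_space \<Rightarrow> 'a"
  assumes "bounded_clinear A" and "\<And>y. cinner (A y) x = cinner y z"
  shows "cadjoint A x = z"
  by (rule cinner_eqI) (metis assms cinner_cadjoint_left cinner_commute)

lemma cadjoint_cadjoint:
  fixes A :: "'a::chilbert_space \<Rightarrow> 'a"
  assumes "bounded_clinear A"
  shows "cadjoint (cadjoint A) = A"
  by (intro ext cadjoint_eqI bounded_clinear_cadjoint cinner_cadjoint_left assms)

subsection \<open>Square roots and defect spaces\<close>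

instance chilbert_space \<subseteq> banach ..

text \<open>A fixed point \<open>Y\<close> of the iteration satisfies \<open>(I - Y)\<^sup>2 = I - X\<close>.\<close>

fun sqrt_iter :: "('a::real_normed_vector \<Rightarrow>\<^sub>L 'a) \<Rightarrow> nat \<Rightarrow> 'a \<Rightarrow>\<^sub>L 'a" where
  "sqrt_iter X 0 = 0"
| "sqrt_iter X (Suc m) = (1 / 2) *\<^sub>R (X + (sqrt_iter X m o\<^sub>L sqrt_iter X m))"

text \<open>
  The iteration at the number 1. It increases to a limit and bounds the steps of the operator
  iteration, which therefore converges in norm.
\<close>

fun sqrt_bound :: "nat \<Rightarrow> real" where
  "sqrt_bound 0 = 0"
| "sqrt_bound (Suc m) = (1 / 2) * (1 + (sqrt_bound m)\<^sup>2)"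

lemma sqrt_bound_range: "0 \<le> sqrt_bound m \<and> sqrt_bound m \<le> 1"
proof (induction m)
  case (Suc m)
  then have "(sqrt_bound m)\<^sup>2 \<le> 1"
    by (simp add: power_le_one)
  then show ?case by simp
qed simp

lemma sqrt_bound_mono: "sqrt_bound m \<le> sqrt_bound (Suc m)"
  using zero_le_power2[of "sqrt_bound m - 1"] by (simp add: power2_eq_square algebra_simps)

lemma norm_sqrt_iter_le:
  assumes "norm X \<le> 1"
  shows "norm (sqrt_iter X m) \<le> sqrt_bound m"
proof (induction m)
  case (Suc m)
  have "norm (sqrt_iter X m o\<^sub>L sqrt_iter X m) \<le> norm (sqrt_iter X m) * norm (sqrt_iter X m)"
    by (rule norm_blinfun_compose)
  also have "\<dots> \<le> (sqrt_bound m)\<^sup>2"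
    unfolding power2_eq_square by (intro mult_mono Suc sqrt_bound_range[THEN conjunct1] norm_ge_zero)
  finally have "norm (X + (sqrt_iter X m o\<^sub>L sqrt_iter X m)) \<le> 1 + (sqrt_bound m)\<^sup>2"
    using assms norm_triangle_ineq[of X "sqrt_iter X m o\<^sub>L sqrt_iter X m"] by linarith
  then show ?case by simp
qed simp

text \<open>The summand X cancels, and A A - B B = A (A - B) + (A - B) B holds without
  commutativity. For \<open>sqrt_bound\<close> the same identity computes the next step exactly, so
  the induction closes without loss.\<close>

lemma norm_sqrt_iter_diff_le:
  assumes X: "norm X \<le> 1"
  shows "norm (sqrt_iter X (Suc m) - sqrt_iter X m) \<le> sqrt_bound (Suc m) - sqrt_bound m"
proof (induction m)
  case (Suc m)
  let ?Y = "sqrt_iter X" and ?y = sqrt_bound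
  have "2 *\<^sub>R (?Y (Suc (Suc m)) - ?Y (Suc m)) = (?Y (Suc m) o\<^sub>L ?Y (Suc m)) - (?Y m o\<^sub>L ?Y m)"
    by (simp only: sqrt_iter.simps(2)[of X "Suc m"] sqrt_iter.simps(2)[of X m] scaleR_diff_right)
      (simp add: algebra_simps)
  also have "\<dots> = (?Y (Suc m) o\<^sub>L (?Y (Suc m) - ?Y m)) + ((?Y (Suc m) - ?Y m) o\<^sub>L ?Y m)"
    by (simp only: bounded_bilinear.diff_left[OF bounded_bilinear_blinfun_compose]
      bounded_bilinear.diff_right[OF bounded_bilinear_blinfun_compose]) simp
  finally have "norm (2 *\<^sub>R (?Y (Suc (Suc m)) - ?Y (Suc m)))
      \<le> norm (?Y (Suc m) o\<^sub>L (?Y (Suc m) - ?Y m)) + norm ((?Y (Suc m) - ?Y m) o\<^sub>L ?Y m)"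
    by (metis norm_triangle_ineq)
  also have "\<dots> \<le> ?y (Suc m) * (?y (Suc m) - ?y m) + (?y (Suc m) - ?y m) * ?y m"
    using sqrt_bound_range sqrt_bound_mono norm_sqrt_iter_le[OF X] Suc
    by (intro add_mono order_trans[OF norm_blinfun_compose] mult_mono) (auto simp del: sqrt_iter.simps sqrt_bound.simps)
  also have "\<dots> = 2 * (?y (Suc (Suc m)) - ?y (Suc m))"
    by (simp add: algebra_simps power2_eq_square)
  finally show ?case by (simp del: sqrt_iter.simps sqrt_bound.simps)
qed (use X in simp)

text \<open>The operators on a Banach space are complete in norm, so a telescoping series dominated
  termwise by that of \<open>sqrt_bound\<close> converges.\<close>

lemma convergent_sqrt_iter:
  fixes X :: "'a::banach \<Rightarrow>\<^sub>L 'a"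
  assumes X: "norm X \<le> 1"
  shows "convergent (sqrt_iter X)"
proof -
  have "incseq sqrt_bound"
    by (rule incseq_SucI) (rule sqrt_bound_mono)
  then obtain l where l: "sqrt_bound \<longlonglongrightarrow> l"
    using incseq_convergent[of sqrt_bound 1] sqrt_bound_range by blast
  have "summable (\<lambda>m. sqrt_bound (Suc m) - sqrt_bound m)"
    using telescope_sums[OF l] by (rule sums_summable)
  then have "summable (\<lambda>m. sqrt_iter X (Suc m) - sqrt_iter X m)"
    by (rule summable_comparison_test'[where N = 0]) (rule norm_sqrt_iter_diff_le[OF X])
  then have "convergent (\<lambda>n. \<Sum>m<n. sqrt_iter X (Suc m) - sqrt_iter X m)"
    by (simp only: summable_iff_convergent)
  then show ?thesis
    by (simp only: sum_lessThan_telescope sqrt_iter.simps(1) diff_zero)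
qed

lemma exists_positive_sqrt:
  fixes X :: "'a::chilbert_space \<Rightarrow> 'a"
  assumes X: "bounded_clinear X" and sym: "\<And>x y. cinner (X x) y = cinner x (X y)"
    and norm: "\<And>x. norm (X x) \<le> norm x"
  shows "\<exists>B. positive_op B \<and> B \<circ> B = (\<lambda>x. x - X x)"
proof -
  \<comment> \<open>The type of bounded operators carries the norm and the limit, but its members
    are only real linear. Complex linearity and symmetry are therefore proved for the iterates and
    passed to the limit \<open>Y\<close>.\<close>
  define X' where "X' = Blinfun X"
  have X'_apply [simp]: "blinfun_apply X' = X"
    unfolding X'_def using bounded_clinearD(1)[OF X] by (rule bounded_linear_Blinfun_apply)
  have X': "norm X' \<le> 1"
    by (rule norm_blinfun_bound) (simp_all add: norm)
  obtain Y where Y: "sqrt_iter X' \<longlonglongrightarrow> Y"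
    using convergent_sqrt_iter[OF X'] by (auto simp: convergent_def)
  have apply_lim: "(\<lambda>m. sqrt_iter X' m x) \<longlonglongrightarrow> Y x" for x
    by (intro tendsto_intros Y)
  have "(\<lambda>m. sqrt_iter X' (Suc m)) \<longlonglongrightarrow> (1 / 2) *\<^sub>R (X' + (Y o\<^sub>L Y))"
    by (simp only: sqrt_iter.simps) (intro tendsto_intros Y)
  with LIMSEQ_Suc[OF Y] have eq: "Y = (1 / 2) *\<^sub>R (X' + (Y o\<^sub>L Y))"
    by (rule LIMSEQ_unique)
  have eq2: "Y (Y x) = Y x + Y x - X x" for x
  proof -
    have "2 *\<^sub>R Y = 2 *\<^sub>R ((1 / 2) *\<^sub>R (X' + (Y o\<^sub>L Y)))"
      by (rule arg_cong[OF eq])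
    also have "\<dots> = X' + (Y o\<^sub>L Y)"
      by simp
    finally have "2 *\<^sub>R Y = X' + (Y o\<^sub>L Y)" .
    then have "2 *\<^sub>R Y x = X x + Y (Y x)"
      by (metis X'_apply blinfun.add_left blinfun.scaleR_left blinfun_apply_blinfun_compose)
    then show ?thesis
      by (simp add: scaleR_2 algebra_simps)
  qed
  have "norm (sqrt_iter X' m) \<le> 1" for m
    using norm_sqrt_iter_le[OF X', of m] sqrt_bound_range[of m] by linarith
  then have "norm Y \<le> 1"
    using LIMSEQ_le_const2[OF tendsto_norm[OF Y]] by blast
  then have Y_norm: "norm (Y x) \<le> norm x" for x
    using norm_blinfun[of Y x] mult_right_mono[of "norm Y" 1 "norm x"] by simp
  have iter_scale: "sqrt_iter X' m (c *\<^sub>C x) = c *\<^sub>C sqrt_iter X' m x" for m c x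
    by (induction m arbitrary: x)
      (simp_all add: blinfun.add_left blinfun.scaleR_left bounded_clinearD(5)[OF X]
        scaleC_add_right linear_scale[OF bounded_linear.linear[OF bounded_linear_scaleC]])
  have Y_scale: "Y (c *\<^sub>C x) = c *\<^sub>C Y x" for c x
    using apply_lim[of "c *\<^sub>C x"] bounded_linear.tendsto[OF bounded_linear_scaleC apply_lim[of x], of c]
    unfolding iter_scale by (rule LIMSEQ_unique)
  have iter_sym: "cinner (sqrt_iter X' m x) y = cinner x (sqrt_iter X' m y)" for m x y
    by (induction m arbitrary: x y)
      (simp_all add: blinfun.add_left blinfun.scaleR_left sym cinner_add_left cinner_add_right
        cinner_scaleR_left cinner_scaleR_right cinner.zero_left cinner.zero_right)
  have Y_sym: "cinner (Y x) y = cinner x (Y y)" for x y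
    using cinner.tendsto[OF apply_lim[of x] tendsto_const[of y]]
      cinner.tendsto[OF tendsto_const[of x] apply_lim[of y]]
    unfolding iter_sym by (rule LIMSEQ_unique)
  let ?B = "\<lambda>x. x - Y x"
  have "bounded_clinear (blinfun_apply Y)"
    by (rule bounded_clinearI[where K = 1]) (auto simp: blinfun.add_right Y_scale Y_norm)
  then have "bounded_clinear ?B"
    by (intro bounded_clinear_diff bounded_clinear_ident)
  \<comment> \<open>Symmetry makes <Y x, x> real and the norm bound keeps it at most |x|^2, so I - Y
    is positive.\<close>
  moreover have "cinner (?B x) x \<in> \<real>\<^sub>\<ge>\<^sub>0" for x
  proof -
    have "Re (cinner (Y x) x) \<le> norm x * norm x"
      using complex_Re_le_cmod[of "cinner (Y x) x"] cinner_norm_le[of "Y x" x]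
        mult_right_mono[OF Y_norm[of x] norm_ge_zero[of x]] by linarith
    moreover have "cinner (Y x) x = cnj (cinner (Y x) x)"
      unfolding cinner_commute[of x "Y x", symmetric] by (rule Y_sym)
    then have "Im (cinner (Y x) x) = 0"
      by (simp add: complex_eq_iff)
    ultimately show ?thesis
      by (simp add: complex_nonneg_Reals_iff cinner.diff_left cinner_self power2_eq_square)
  qed
  ultimately have "positive_op ?B"
    by (simp add: positive_op_def)
  moreover have "?B \<circ> ?B = (\<lambda>x. x - X x)"
    by (auto simp: blinfun.diff_right eq2)
  ultimately show ?thesis by blast
qed

text \<open>The diagonal of the form is real, and polarisation over the complex scalars extends this
  to symmetry.\<close>

lemma positive_op_symmetric:
  assumes "positive_op B"
  shows "cinner (B x) y = cinner x (B y)"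
proof -
  have B: "bounded_clinear B" and pos: "\<And>x. cinner (B x) x \<in> \<real>\<^sub>\<ge>\<^sub>0"
    using assms by (auto simp: positive_op_def)
  define h where "h u v = cinner (B u) v - cinner u (B v)" for u v
  have "h u u = 0" for u
  proof -
    obtain r where "cinner (B u) u = complex_of_real r"
      using pos[of u] by (rule nonneg_Reals_cases)
    then show ?thesis
      using cinner_commute[of u "B u"] by (simp add: h_def)
  qed
  then have "h x y = 0"
    by (rule sesquilinear_zero_if_diagonal_zero[rotated 4])
      (simp_all add: h_def bounded_clinearD[OF B] cinner_add_left cinner_add_right
        cinner_scaleC_left cinner_scaleC_right right_diff_distrib)
  then show ?thesis by (simp add: h_def)
qed

section \<open>Defect spaces as complements of kernels\<close>

lemma contraction_cadjoint:
  fixes T :: "'a::chilbert_space \<Rightarrow> 'a"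
  assumes "contraction T"
  shows "contraction (cadjoint T)"
proof -
  have T: "bounded_clinear T" and le: "\<And>x. norm (T x) \<le> norm x"
    using assms by (auto simp: contraction_def)
  have "norm (cadjoint T x) \<le> norm x" for x
  proof -
    have "(norm (cadjoint T x))\<^sup>2 = cmod (cinner (T (cadjoint T x)) x)"
      by (simp add: cinner_self norm_power flip: cinner_cadjoint_right[OF T])
    also have "\<dots> \<le> norm (cadjoint T x) * norm x"
      using cinner_norm_le[of "T (cadjoint T x)" x]
        mult_right_mono[OF le[of "cadjoint T x"] norm_ge_zero[of x]] by simp
    finally show ?thesis
      by (cases "cadjoint T x = 0") (auto simp: power2_eq_square)
  qed
  then show ?thesis
    by (simp add: contraction_def bounded_clinear_cadjoint[OF T])
qed

text \<open>For symmetric B the complement of the range is ker B, and |B x|^2 = <x, B B x> shows ker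
  B = ker B^2. The square root disappears here: from now on a defect space is handled through fixed
  vectors only.\<close>

lemma defect_space_eq:
  fixes T :: "'a::chilbert_space \<Rightarrow> 'a"
  assumes "contraction T"
  shows "defect_space T = orth_compl {x. cadjoint T (T x) = x}"
proof -
  have T: "bounded_clinear T" and le: "\<And>x. norm (T x) \<le> norm x"
    using assms by (auto simp: contraction_def)
  have le': "\<And>x. norm (cadjoint T x) \<le> norm x"
    using contraction_cadjoint[OF assms] by (auto simp: contraction_def)
  define B where "B = sqrt_op (\<lambda>x. x - cadjoint T (T x))"
  have "\<exists>B. positive_op B \<and> B \<circ> B = (\<lambda>x. x - cadjoint T (T x))"
  proof (rule exists_positive_sqrt)
    show "norm (cadjoint T (T x)) \<le> norm x" for x
      by (rule order_trans[OF le' le])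
  qed (simp_all add: bounded_clinear_compose[OF bounded_clinear_cadjoint[OF T] T]
      cinner_cadjoint_left[OF T] cinner_cadjoint_right[OF T])
  then have "positive_op B \<and> B \<circ> B = (\<lambda>x. x - cadjoint T (T x))"
    unfolding B_def sqrt_op_def by (rule someI_ex)
  then have pos: "positive_op B" and BB: "\<And>x. B (B x) = x - cadjoint T (T x)"
    by (auto simp: fun_eq_iff)
  note sym = positive_op_symmetric[OF pos]
  have B: "bounded_clinear B"
    using pos by (simp add: positive_op_def)
  have "orth_compl (range B) = {x. B x = 0}"
  proof -
    have "(\<forall>y. cinner x (B y) = 0) \<longleftrightarrow> B x = 0" for x
      unfolding sym[symmetric] using cinner_eqI[of "B x" 0] by (auto simp: cinner.zero_left)
    then show ?thesis by (auto simp: orth_compl_def)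
  qed
  also have "\<dots> = {x. cadjoint T (T x) = x}"
  proof -
    have "B x = 0" if "B (B x) = 0" for x
      using sym[of x "B x"] that by (simp add: cinner.zero_right)
    moreover have "B (B x) = 0" if "B x = 0" for x
      using that bounded_clinearD(4)[OF B] by simp
    ultimately show ?thesis
      unfolding BB by auto
  qed
  finally have "orth_compl (range B) = {x. cadjoint T (T x) = x}" .
  moreover have "defect_space T = orth_compl (orth_compl (range B))"
    unfolding defect_space_def B_def[symmetric]
    by (rule closure_eq_orth_compl_orth_compl) (rule csubspace_range[OF B complex_vector.subspace_UNIV])
  ultimately show ?thesis by simp
qed

subsection \<open>Finite-dimensional subspaces and orthonormal families\<close>

text \<open>A vector of V missed by A would extend the image of a basis of V to an independent
  subset of V with one element too many.\<close>

lemma injective_imp_surjective_subspace: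
  assumes A: "bounded_clinear A" and V: "csubspace V" and fin: "finite W" "V \<subseteq> cspan W"
    and into: "A ` V \<subseteq> V" and inj: "\<And>x. x \<in> V \<Longrightarrow> A x = 0 \<Longrightarrow> x = 0"
  shows "A ` V = V"
proof (rule ccontr)
  assume "A ` V \<noteq> V"
  with into have "A ` V \<subset> V" by simp
  then obtain y where y: "y \<in> V" "y \<notin> A ` V"
    using psubset_imp_ex_mem[of "A ` V" V] by auto
  obtain B where B: "B \<subseteq> V" "complex_vector.independent B" "V \<subseteq> cspan B"
    by (rule complex_vector.basis_exists[of V])
  have finB: "finite B"
    using complex_vector.independent_span_bound[OF fin(1) B(2)] order_trans[OF B(1) fin(2)] by simp
  have span_B: "cspan B = V"
    by (intro subset_antisym complex_vector.span_minimal[OF B(1) V] B(3))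
  have "inj_on A V"
  proof (rule inj_onI)
    fix u v assume "u \<in> V" "v \<in> V" "A u = A v"
    then have "u - v = 0"
      by (intro inj[of "u - v"]) (auto simp: bounded_clinearD(3)[OF A] csubspaceD(4)[OF V])
    then show "u = v" by simp
  qed
  interpret A: Vector_Spaces.linear scaleC scaleC A
    by unfold_locales (simp_all add: bounded_clinearD[OF A])
  have "complex_vector.independent (A ` B)"
    using B(2) \<open>inj_on A V\<close> unfolding span_B[symmetric] cspan_def
    by (rule A.independent_injective_image)
  moreover have "cspan (A ` B) \<subseteq> A ` V"
    by (intro complex_vector.span_minimal image_mono B(1) csubspace_range[OF A V])
  ultimately have "complex_vector.independent (insert y (A ` B))"
    using y by (intro complex_vector.independent_insertI) auto
  moreover have "insert y (A ` B) \<subseteq> cspan B"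
    unfolding span_B using y(1) into image_mono[OF B(1), of A] by simp
  ultimately have "card (insert y (A ` B)) \<le> card B"
    using complex_vector.independent_span_bound[OF finB, of "insert y (A ` B)"] by simp
  moreover have "card (insert y (A ` B)) = Suc (card B)"
  proof -
    have "y \<notin> A ` B"
      using y(2) B(1) by blast
    then show ?thesis
      using finB card_image[OF inj_on_subset[OF \<open>inj_on A V\<close> B(1)]] by simp
  qed
  ultimately show False by simp
qed

section \<open>Orthonormal families and Gram-Schmidt\<close>

definition orthonormal_on :: "'i set \<Rightarrow> ('i \<Rightarrow> 'a::complex_inner) \<Rightarrow> bool" where
  "orthonormal_on I e \<longleftrightarrow> (\<forall>i\<in>I. \<forall>j\<in>I. cinner (e i) (e j) = (if i = j then 1 else 0))"

lemma cinner_orthonormal_sum: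
  assumes "orthonormal_on I e" and "finite I" and "j \<in> I"
  shows "cinner (\<Sum>i\<in>I. c i *\<^sub>C e i) (e j) = c j"
proof -
  have "cinner (\<Sum>i\<in>I. c i *\<^sub>C e i) (e j) = (\<Sum>i\<in>I. if i = j then c i else 0)"
    unfolding cinner.sum_left
    by (rule sum.cong) (use assms in \<open>auto simp: orthonormal_on_def cinner_scaleC_left\<close>)
  then show ?thesis
    using assms by simp
qed

lemma inj_on_orthonormal:
  assumes "orthonormal_on I e"
  shows "inj_on e I"
proof (rule inj_onI)
  fix i j assume "i \<in> I" "j \<in> I" "e i = e j"
  then show "i = j"
    using assms unfolding orthonormal_on_def by (metis zero_neq_one)
qed

lemma orthonormal_sum_in_span: "(\<Sum>i\<in>I. c i *\<^sub>C e i) \<in> cspan (e ` I)"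
  by (intro complex_vector.span_sum complex_vector.span_scale complex_vector.span_base) auto

lemma orthonormal_residual:
  assumes "orthonormal_on I e" and "finite I"
  shows "x - (\<Sum>i\<in>I. cinner x (e i) *\<^sub>C e i) \<in> orth_compl (cspan (e ` I))"
  unfolding orth_compl_cspan
  using cinner_orthonormal_sum[OF assms] by (auto simp: orth_compl_def cinner.diff_left)

text \<open>Replaces the \<open>THE\<close> in the projection by a finite sum, from which
  boundedness and symmetry can be read off.\<close>

lemma orth_proj_orthonormal:
  assumes "orthonormal_on I e" and "finite I"
  shows "orth_proj (cspan (e ` I)) x = (\<Sum>i\<in>I. cinner x (e i) *\<^sub>C e i)"
  by (intro orth_proj_eqI orthonormal_sum_in_span orthonormal_residual assms
      complex_vector.subspace_span)

lemma independent_orthonormal: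
  assumes e: "orthonormal_on I e" and "finite I"
  shows "complex_vector.independent (e ` I)"
proof (rule complex_vector.independent_if_scalars_zero)
  fix f x assume *: "(\<Sum>x\<in>e ` I. f x *\<^sub>C x) = 0" "x \<in> e ` I"
  then obtain j where j: "j \<in> I" "x = e j" by blast
  have "(\<Sum>i\<in>I. f (e i) *\<^sub>C e i) = 0"
    using *(1) by (simp add: sum.reindex[OF inj_on_orthonormal[OF e]])
  then show "f x = 0"
    using cinner_orthonormal_sum[OF e \<open>finite I\<close> j(1), of "\<lambda>i. f (e i)"] j
    by (simp add: cinner.zero_left)
qed (use assms in simp)

text \<open>Gram-Schmidt, one vector at a time. The result is a set, viewed as a family indexed by
  itself, so that no enumeration has to be carried through the induction.\<close>

lemma exists_orthonormal_span:
  assumes "finite B"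
  shows "\<exists>E. finite E \<and> orthonormal_on E (\<lambda>x. x) \<and> cspan E = cspan (B :: 'a::complex_inner set)"
  using assms
proof (induction B)
  case empty
  show ?case by (rule exI[of _ "{}"]) (simp add: orthonormal_on_def)
next
  case (insert b B)
  then obtain E where E: "finite E" "orthonormal_on E (\<lambda>x. x)" "cspan E = cspan B"
    by blast
  define p where "p = (\<Sum>i\<in>E. cinner b i *\<^sub>C i)"
  have p: "p \<in> cspan E" "b - p \<in> orth_compl (cspan E)"
    using orthonormal_sum_in_span[of "cinner b" "\<lambda>x. x" E] orthonormal_residual[OF E(2,1), of b]
    by (auto simp: p_def)
  show ?case
  proof (cases "b = p")
    case True
    then have "cspan (insert b B) = cspan E"
      using p(1) E(3) by (simp add: complex_vector.span_redundant)
    with E show ?thesis by metis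
  next
    case False
    define c where "c = complex_of_real (1 / norm (b - p))"
    define u where "u = c *\<^sub>C (b - p)"
    have c0: "c \<noteq> 0" using False by (simp add: c_def)
    have "norm u = 1"
      using False by (simp add: u_def c_def norm_scaleC norm_divide)
    then have uu: "cinner u u = 1" by (simp add: cinner_self)
    have uE: "cinner u x = 0" if "x \<in> E" for x
      using p(2) that complex_vector.span_base[of x E]
      by (auto simp: u_def cinner_scaleC_left orth_compl_def)
    then have Eu: "cinner x u = 0" if "x \<in> E" for x
      using uE[OF that] by (simp add: cinner_eq_0_commute[of x u])
    have "u \<notin> E" using uE[of u] uu by auto
    with E(2) uu uE Eu have "orthonormal_on (insert u E) (\<lambda>x. x)"
      by (auto simp: orthonormal_on_def)
    moreover have "cspan (insert u E) = cspan (insert b B)"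
    proof -
      have "p \<in> cspan (insert u E)" "p \<in> cspan (insert b B)"
        using p(1) E(3) complex_vector.span_mono[of E "insert u E"]
          complex_vector.span_mono[of B "insert b B"] by auto
      then have "(1 / c) *\<^sub>C u + p \<in> cspan (insert u E)" and "b - p \<in> cspan (insert b B)"
        by (simp_all add: complex_vector.span_add complex_vector.span_diff
            complex_vector.span_scale complex_vector.span_base)
      then have u: "u \<in> cspan (insert b B)"
        unfolding u_def by (intro complex_vector.span_scale)
      have "(1 / c) *\<^sub>C u + p = b"
        using c0 by (simp add: u_def scaleC_scaleC scaleC_one)
      with \<open>(1 / c) *\<^sub>C u + p \<in> cspan (insert u E)\<close> have "b \<in> cspan (insert u E)" by simp
      note this u
      moreover have "B \<subseteq> cspan (insert u E)"
        using E(3) complex_vector.span_superset[of B] complex_vector.span_mono[of E "insert u E"] by auto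
      moreover have "E \<subseteq> cspan (insert b B)"
        using E(3) complex_vector.span_superset[of E] complex_vector.span_mono[of B "insert b B"] by auto
      ultimately show ?thesis
        by (intro subset_antisym complex_vector.span_minimal complex_vector.subspace_span) auto
    qed
    ultimately show ?thesis
      using E(1) by (intro exI[of _ "insert u E"]) auto
  qed
qed

lemma exists_orthonormal_basis_of_subspace:
  assumes V: "csubspace V" and dim: "cdim V = n" "n \<ge> 1"
  obtains e :: "nat \<Rightarrow> 'a::complex_inner" where "orthonormal_on {1..n} e" "cspan (e ` {1..n}) = V"
proof -
  obtain B where B: "B \<subseteq> V" "V \<subseteq> cspan B" "card B = cdim V"
    by (rule complex_vector.basis_exists[of V])
  \<comment> \<open>An infinite \<open>B\<close> would have cardinality 0, which
    \<open>n \<ge> 1\<close> excludes.\<close>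
  have "finite B"
    using B(3) dim by (auto intro: card_ge_0_finite)
  have "cspan B = V"
    by (intro subset_antisym complex_vector.span_minimal[OF B(1) V] B(2))
  with exists_orthonormal_span[OF \<open>finite B\<close>]
  obtain E where E: "finite E" "orthonormal_on E (\<lambda>x. x)" "cspan E = V"
    by auto
  have "complex_vector.independent E"
    using independent_orthonormal[OF E(2,1)] by simp
  then have "card E = n"
    using complex_vector.dim_span_eq_card_independent[of E] E(3) dim(1) by simp
  then obtain e where e: "bij_betw e {1..n} E"
    using ex_bij_betw_nat_finite_1[OF E(1)] by auto
  then have "e ` {1..n} = E"
    by (rule bij_betw_imp_surj_on)
  moreover have "orthonormal_on {1..n} e"
    unfolding orthonormal_on_def
  proof (intro ballI)
    fix i j assume ij: "i \<in> {1..n}" "j \<in> {1..n}"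
    then have "e i \<in> E" "e j \<in> E" "e i = e j \<longleftrightarrow> i = j"
      using inj_on_eq_iff[OF bij_betw_imp_inj_on[OF e]] bij_betwE[OF e] by simp_all
    then show "cinner (e i) (e j) = (if i = j then 1 else 0)"
      using E(2) by (auto simp: orthonormal_on_def)
  qed
  ultimately show ?thesis
    using E(3) that[of e] by simp
qed

lemma closure_cspan_eq_UNIV:
  fixes B :: "'a::chilbert_space set"
  assumes "orth_compl B = {0}"
  shows "closure (cspan B) = UNIV"
proof -
  have "closure (cspan B) = orth_compl {0}"
    using assms closure_eq_orth_compl_orth_compl[OF complex_vector.subspace_span, of B]
    by (simp add: orth_compl_cspan)
  then show ?thesis
    by (auto simp: orth_compl_def cinner.zero_right)
qed

text \<open>A kernel is a closed subspace, so identities between operators may be checked on basis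
  vectors.\<close>

lemma bounded_clinear_eq_0_on_basis:
  assumes e: "orthonormal_basis e" and A: "bounded_clinear A" and "\<And>m. m \<ge> 1 \<Longrightarrow> A (e m) = 0"
  shows "A x = 0"
proof -
  have "cspan (e ` {1..}) \<subseteq> {x. A x = 0}"
    by (rule complex_vector.span_minimal[OF _ csubspace_ker[OF A]]) (use assms in auto)
  then have "closure (cspan (e ` {1..})) \<subseteq> {x. A x = 0}"
    by (rule closure_minimal[OF _ closed_ker[OF A]])
  then show ?thesis
    using e by (auto simp: orthonormal_basis_def)
qed

subsection \<open>Operators in block form\<close>

text \<open>Polarising |A x|^2 - |A* x|^2 = 0 gives <A x, A z> = <A* x, A* z> for all z.\<close>

lemma cadjoint_commutes_if_norm_eq:
  fixes A :: "'a::chilbert_space \<Rightarrow> 'a"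
  assumes A: "bounded_clinear A" and norm: "\<And>x. norm (cadjoint A x) = norm (A x)"
  shows "cadjoint A (A x) = A (cadjoint A x)"
proof (rule cinner_eqI)
  fix z
  note A' = bounded_clinear_cadjoint[OF A]
  define h where "h u v = cinner (A u) (A v) - cinner (cadjoint A u) (cadjoint A v)" for u v
  have "h u u = 0" for u
    by (simp add: h_def cinner_self norm)
  then have "h x z = 0"
    by (rule sesquilinear_zero_if_diagonal_zero[rotated 4])
      (simp_all add: h_def bounded_clinearD[OF A] bounded_clinearD[OF A'] cinner_add_left
        cinner_add_right cinner_scaleC_left cinner_scaleC_right right_diff_distrib)
  then show "cinner (cadjoint A (A x)) z = cinner (A (cadjoint A x)) z"
    by (simp add: h_def cinner_cadjoint_left[OF A] cinner_cadjoint_right[OF A])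
qed

lemma bounded_clinear_rank_one: "bounded_clinear (\<lambda>x. cinner x a *\<^sub>C b)"
proof (rule bounded_clinearI[where K = "norm a * norm b"])
  show "norm (cinner x a *\<^sub>C b) \<le> norm x * (norm a * norm b)" for x
    using mult_right_mono[OF cinner_norm_le[of x a] norm_ge_zero[of b]]
    by (simp add: norm_scaleC mult.assoc)
qed (simp_all add: cinner_add_left cinner_scaleC_left scaleC_add_left scaleC_scaleC)

lemma bounded_clinear_sum:
  assumes "\<And>i. i \<in> I \<Longrightarrow> bounded_clinear (f i)"
  shows "bounded_clinear (\<lambda>x. \<Sum>i\<in>I. f i x)"
  using assms
  by (simp add: bounded_clinear_def bounded_linear_sum complex_vector.scale_sum_right)

lemma orthonormal_basis_on:
  assumes "orthonormal_basis e" and "I \<subseteq> {1..}"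
  shows "orthonormal_on I e"
  using assms by (auto simp: orthonormal_basis_def orthonormal_on_def subset_iff)

lemma orthonormal_basis_eq_0:
  fixes e :: "nat \<Rightarrow> 'a::chilbert_space"
  assumes e: "orthonormal_basis e" and u: "\<And>m. m \<ge> 1 \<Longrightarrow> cinner u (e m) = 0"
  shows "u = 0"
proof -
  have "u \<in> orth_compl (closure (cspan (e ` {1..})))"
    unfolding orth_compl_closure orth_compl_cspan using u by (auto simp: orth_compl_def)
  moreover have "u \<in> closure (cspan (e ` {1..}))"
    using e by (simp add: orthonormal_basis_def)
  ultimately show ?thesis
    by (intro orth_compl_inter[of u "closure (cspan (e ` {1..}))"])
qed

lemma shift_isometry:
  fixes S :: "'a::chilbert_space \<Rightarrow> 'a"
  assumes e: "orthonormal_basis e" and S: "bounded_clinear S"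
    and Se: "\<And>m. m \<ge> 1 \<Longrightarrow> S (e m) = e (m + k)"
  shows "cinner (S x) (S y) = cinner x y"
proof -
  have ip: "cinner (e i) (e j) = (if i = j then 1 else 0)" if "i \<ge> 1" "j \<ge> 1" for i j
    using e that by (simp add: orthonormal_basis_def)
  have SS: "bounded_clinear (\<lambda>x. cadjoint S (S x) - x)"
    by (intro bounded_clinear_diff bounded_clinear_ident
        bounded_clinear_compose[OF bounded_clinear_cadjoint[OF S] S])
  \<comment> \<open>Tested against each e j, the claim compares <e (m + k), e (j + k)> with <e m, e
    j>.\<close>
  have "cadjoint S (S (e m)) - e m = 0" if m: "m \<ge> 1" for m
    by (rule orthonormal_basis_eq_0[OF e])
      (use m in \<open>simp add: cinner.diff_left cinner_cadjoint_left[OF S] Se ip\<close>)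
  then have "cadjoint S (S x) - x = 0"
    by (rule bounded_clinear_eq_0_on_basis[OF e SS])
  then have "cadjoint S (S x) = x" by simp
  then show ?thesis
    using cinner_cadjoint_left[OF S, of "S x" y] by simp
qed

text \<open>The ranges of S (I - P) and \<open>F\<^sub>1\<close> are orthogonal, so T*T is I - P
  plus the positive operator \<open>G\<close> built from \<open>F\<^sub>1\<close>. Commutation with
  T then reduces to \<open>F\<^sub>1\<close> commuting with \<open>G\<close>, which follows from
  normality of \<open>F\<^sub>1\<close>.\<close>

lemma quasinormal_block_form:
  fixes T F\<^sub>1 :: "'a::chilbert_space \<Rightarrow> 'a"
  assumes T: "bounded_clinear T" and F: "bounded_clinear F\<^sub>1"
    and e: "orthonormal_basis e" and S: "bounded_clinear S"
    and Se: "\<And>m. m \<ge> 1 \<Longrightarrow> S (e m) = e (m + k)"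
    and P_def: "P = orth_proj (cspan (e ` {1..n}))"
    and T_eq: "\<And>x. T x = S (x - P x) + F\<^sub>1 x"
    and FP: "\<And>x. F\<^sub>1 (P x) = F\<^sub>1 x" and PF: "\<And>x. P (F\<^sub>1 x) = F\<^sub>1 x"
    and norm: "\<And>x. norm (cadjoint F\<^sub>1 x) = norm (F\<^sub>1 x)"
  shows "quasinormal T"
proof -
  have on: "orthonormal_on {1..n} e"
    using e by (rule orthonormal_basis_on) auto
  have P: "P x = (\<Sum>i\<in>{1..n}. cinner x (e i) *\<^sub>C e i)" for x
    unfolding P_def by (rule orth_proj_orthonormal[OF on]) simp
  have ip: "cinner (e i) (e j) = (if i = j then 1 else 0)" if "i \<ge> 1" "j \<ge> 1" for i j
    using e that by (simp add: orthonormal_basis_def)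
  have Pb: "bounded_clinear P"
    unfolding P[THEN ext] by (intro bounded_clinear_sum bounded_clinear_rank_one)
  have P_sym: "cinner (P x) y = cinner x (P y)" for x y
    unfolding P cinner.sum_left cinner.sum_right cinner_scaleC_left cinner_scaleC_right
    by (rule sum.cong) (simp_all add: mult.commute flip: cinner_commute)
  have Pe: "P (e m) = (if m \<le> n then e m else 0)" if m: "m \<ge> 1" for m
  proof -
    have "P (e m) = (\<Sum>i\<in>{1..n}. if i = m then e m else 0)"
      unfolding P by (rule sum.cong) (use m in \<open>auto simp: ip scaleC_one\<close>)
    then show ?thesis using m by simp
  qed
  have PP: "P (P x) = P x" for x
  proof -
    have "P (P x) = (\<Sum>i\<in>{1..n}. cinner x (e i) *\<^sub>C P (e i))"
      by (subst (2) P) (simp add: bounded_clinearD[OF Pb])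
    also have "\<dots> = P x"
      by (subst P) (rule sum.cong, simp_all add: Pe)
    finally show ?thesis .
  qed
  \<comment> \<open>For m \<le> n the vector e m - P (e m) is zero already; for m > n the shift only
    moves e m further away from the range of P.\<close>
  have PS: "P (S (x - P x)) = 0" for x
  proof (rule bounded_clinear_eq_0_on_basis[OF e, where A = "\<lambda>x. P (S (x - P x))"])
    show "bounded_clinear (\<lambda>x. P (S (x - P x)))"
      by (intro bounded_clinear_compose[OF Pb] bounded_clinear_compose[OF S]
          bounded_clinear_diff bounded_clinear_ident Pb)
    show "P (S (e m - P (e m))) = 0" if "m \<ge> 1" for m
      using that by (simp add: Pe bounded_clinearD(4)[OF S] bounded_clinearD(4)[OF Pb] Se)
  qed
  have FS: "F\<^sub>1 (S (x - P x)) = 0" for x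
    using FP[of "S (x - P x)"] by (simp add: PS bounded_clinearD(4)[OF F])
  define G where "G x = cadjoint F\<^sub>1 (F\<^sub>1 x)" for x
  have G_eq: "G x = F\<^sub>1 (cadjoint F\<^sub>1 x)" for x
    unfolding G_def by (rule cadjoint_commutes_if_norm_eq[OF F norm])
  \<comment> \<open>By normality \<open>G\<close> may be written with \<open>F\<^sub>1\<close> as
    the outer factor, whose range P fixes.\<close>
  have PG: "P (G x) = G x" for x
    unfolding G_eq by (rule PF)
  have TT: "cadjoint T (T x) = (x - P x) + G x" for x
  proof (rule cadjoint_eqI[OF T])
    fix y
    have 1: "cinner (S (u - P u)) (F\<^sub>1 v) = 0" for u v
      using P_sym[of "S (u - P u)" "F\<^sub>1 v"] by (simp add: PS PF cinner.zero_left)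
    then have 2: "cinner (F\<^sub>1 v) (S (u - P u)) = 0" for u v
      by (simp add: cinner_eq_0_commute[of "F\<^sub>1 v"])
    have "cinner (y - P y) (x - P x) = cinner y (x - P x)"
      using P_sym[of y "x - P x"]
      by (simp add: cinner.diff_left bounded_clinearD(3)[OF Pb] PP cinner.zero_right)
    then show "cinner (T y) (T x) = cinner y (x - P x + G x)"
      unfolding T_eq G_def
      by (simp only: cinner_add_left cinner_add_right 1 2 shift_isometry[OF e S Se]
          cinner_cadjoint_right[OF F] add_0_left add_0_right)
  qed
  have "T (cadjoint T (T x)) = cadjoint T (T (T x))" for x
  proof -
    have "T (cadjoint T (T x)) = S (x - P x) + F\<^sub>1 (G x)"
      unfolding TT T_eq[of "(x - P x) + G x"]
      by (simp add: bounded_clinearD[OF Pb] bounded_clinearD[OF F] PP PG FP)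
    moreover have "cadjoint T (T (T x)) = S (x - P x) + G (F\<^sub>1 x)"
      unfolding TT T_eq[of x] G_def
      by (simp add: bounded_clinearD(2)[OF Pb] bounded_clinearD(2)[OF F] PS PF FS)
    moreover have "F\<^sub>1 (G x) = G (F\<^sub>1 x)"
      unfolding G_eq[of "F\<^sub>1 x"] by (simp add: G_def)
    ultimately show ?thesis by simp
  qed
  then show ?thesis
    by (auto simp: quasinormal_def)
qed

subsection \<open>The reducing decomposition of a quasinormal contraction\<close>

locale quasinormal_contraction =
  fixes T :: "'a::chilbert_space \<Rightarrow> 'a"
  assumes contraction: "contraction T" and quasinormal: "quasinormal T"
begin

text \<open>This is the complement of \<open>D\<close>, by \<open>orth_compl_D\<close>; in
  fixed-point form the commutation relations apply to it directly.\<close>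

definition K where "K = {x. cadjoint T (T x) = x}"

abbreviation "D \<equiv> defect_space T"

lemma T: "bounded_clinear T" and T': "bounded_clinear (cadjoint T)"
  using contraction contraction_cadjoint[OF contraction] by (auto simp: contraction_def)

lemma TTT: "T (cadjoint T (T x)) = cadjoint T (T (T x))"
  using quasinormal by (auto simp: quasinormal_def fun_eq_iff)

text \<open>Obtained from \<open>TTT\<close> by taking adjoints. The two relations together make
  \<open>K\<close>, and hence \<open>D\<close>, invariant under both T and T*.\<close>

lemma TTT': "cadjoint T (T (cadjoint T x)) = cadjoint T (cadjoint T (T x))"
proof (rule cinner_eqI)
  fix z
  have "cinner (cadjoint T (T (cadjoint T x))) z = cinner x (T (cadjoint T (T z)))"
    by (simp only: cinner_cadjoint_left[OF T] cinner_cadjoint_right[OF T, symmetric])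
  also have "\<dots> = cinner (cadjoint T (cadjoint T (T x))) z"
    by (simp only: TTT cinner_cadjoint_left[OF T] cinner_cadjoint_right[OF T])
  finally show "cinner (cadjoint T (T (cadjoint T x))) z = cinner (cadjoint T (cadjoint T (T x))) z" .
qed

lemma D_eq: "D = orth_compl K"
  unfolding K_def by (rule defect_space_eq[OF contraction])

lemma csubspace_D: "csubspace D"
  unfolding D_eq by (rule csubspace_orth_compl)

lemma bounded_clinear_defect: "bounded_clinear (\<lambda>x. x - cadjoint T (T x))"
  by (intro bounded_clinear_diff bounded_clinear_ident bounded_clinear_compose[OF T' T])

lemma K_ker: "K = {x. x - cadjoint T (T x) = 0}"
  by (auto simp: K_def)

lemma csubspace_K: "csubspace K"
  unfolding K_ker by (rule csubspace_ker[OF bounded_clinear_defect])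

lemma orth_compl_D: "orth_compl D = K"
  unfolding D_eq
  by (rule orth_compl_orth_compl[OF csubspace_K])
    (unfold K_ker, rule closed_ker[OF bounded_clinear_defect])

lemma cinner_D_K: "x \<in> D \<Longrightarrow> y \<in> K \<Longrightarrow> cinner x y = 0"
  by (auto simp: D_eq orth_compl_def)

lemma D_K_zero: "x \<in> D \<Longrightarrow> x \<in> K \<Longrightarrow> x = 0"
  using cinner_D_K[of x x] by simp

lemma K_T: "x \<in> K \<Longrightarrow> T x \<in> K"
  by (simp add: K_def flip: TTT)

lemma K_T': "x \<in> K \<Longrightarrow> cadjoint T x \<in> K"
  by (simp add: K_def TTT')

lemma D_T: "x \<in> D \<Longrightarrow> T x \<in> D"
  using K_T' by (auto simp: D_eq orth_compl_def simp flip: cinner_cadjoint_right[OF T])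

lemma D_T': "x \<in> D \<Longrightarrow> cadjoint T x \<in> D"
  using K_T by (auto simp: D_eq orth_compl_def cinner_cadjoint_left[OF T])

lemma isometric_on_K: "x \<in> K \<Longrightarrow> cinner (T x) (T y) = cinner x y"
  by (simp add: K_def flip: cinner_cadjoint_left[OF T])

text \<open>If T x = 0, then \<open>TTT'\<close> gives T*T T* x = 0. Pairing with T* x yields T T* x
  = 0, and pairing that with x yields T* x = 0.\<close>

lemma ker_subset: "T x = 0 \<Longrightarrow> cadjoint T x = 0"
proof -
  assume x: "T x = 0"
  then have "cadjoint T (T (cadjoint T x)) = 0"
    using TTT'[of x] by (simp add: bounded_clinearD(4)[OF T'])
  then have "cinner (T (cadjoint T x)) (T (cadjoint T x)) = 0"
    unfolding cinner_cadjoint_left[OF T, symmetric] by (simp add: cinner.zero_left)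
  then have "T (cadjoint T x) = 0" by simp
  then have "cinner (cadjoint T x) (cadjoint T x) = 0"
    by (simp add: cinner_cadjoint_right[OF T] cinner.zero_left)
  then show ?thesis by simp
qed

lemma wandering_subspace_eq:
  "defect_space (cadjoint T) \<inter> orth_compl D = K \<inter> {x. cadjoint T x = 0}"
proof -
  let ?E = "{x. T (cadjoint T x) = x}"
  have D': "defect_space (cadjoint T) = orth_compl ?E"
    using defect_space_eq[OF contraction_cadjoint[OF contraction]]
    by (simp add: cadjoint_cadjoint[OF T])
  have "cadjoint T x = 0" if x: "x \<in> K" "x \<in> orth_compl ?E" for x
  proof -
    \<comment> \<open>Since T* x is in \<open>K\<close>, the vector T T* x is fixed by T T*.
      Orthogonality of x to it says that |T* x|^2 = 0.\<close>
    have "cadjoint T (T (cadjoint T x)) = cadjoint T x"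
      using K_T'[OF x(1)] by (simp add: K_def)
    then have "cinner x (T (cadjoint T x)) = 0"
      using x(2) by (simp add: orth_compl_def)
    then have "cinner (cadjoint T x) (cadjoint T x) = 0"
      by (simp add: cinner_cadjoint_left[OF T])
    then show ?thesis by simp
  qed
  moreover have "x \<in> orth_compl ?E" if x: "cadjoint T x = 0" for x
  proof -
    have "cinner x y = 0" if "y \<in> ?E" for y
      using that cinner_cadjoint_left[OF T, of x "cadjoint T y"] x
      by (simp add: cinner.zero_left)
    then show ?thesis by (simp add: orth_compl_def)
  qed
  ultimately show ?thesis
    unfolding orth_compl_D D' by blast
qed

lemma strict_contraction_on_D:
  assumes x: "x \<in> D" "x \<noteq> 0"
  shows "norm (T x) < norm x"
proof (rule ccontr)
  assume "\<not> norm (T x) < norm x"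
  then have eq: "norm (T x) = norm x"
    using contraction by (simp add: contraction_def order_antisym not_less)
  have "norm (cadjoint T (T x)) \<le> norm (T x)"
    using contraction_cadjoint[OF contraction] by (simp add: contraction_def)
  then have "(norm (cadjoint T (T x)))\<^sup>2 \<le> (norm x)\<^sup>2"
    using eq by (intro power_mono) auto
  moreover have "Re (cinner (cadjoint T (T x)) x) = (norm x)\<^sup>2"
    by (simp add: cinner_cadjoint_left[OF T] cinner_self eq flip: of_real_power)
  \<comment> \<open>Expanding the square leaves at most |x|^2 + |x|^2 - 2 |x|^2, so equality of
    norms forces x to be fixed by T*T.\<close>
  ultimately have "(norm (cadjoint T (T x) - x))\<^sup>2 \<le> 0"
    unfolding norm_diff_sq by simp
  then have "x \<in> K"
    by (simp add: K_def)
  with x D_K_zero show False by blast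
qed

text \<open>
  On a finite-dimensional space, \<open>T\<close> is a bijection of \<open>D \<ominus> ker T\<close>, so that every vector of \<open>D\<close>
  is the sum of one in the range of \<open>T\<close> and one in \<open>ker T\<close>. The commutator vanishes on both.
\<close>

lemma normal_on_D:
  assumes fin: "finite W" "D \<subseteq> cspan W" and x: "x \<in> D"
  shows "T (cadjoint T x) = cadjoint T (T x)"
proof -
  let ?N = "{x. T x = 0}"
  let ?M = "D \<inter> orth_compl ?N"
  have M: "csubspace ?M"
    by (intro complex_vector.subspace_inter csubspace_D csubspace_orth_compl)
  have TM: "T ` ?M = ?M"
  proof (rule injective_imp_surjective_subspace[OF T M fin(1)])
    show "?M \<subseteq> cspan W"
      using fin(2) by blast
    show "T ` ?M \<subseteq> ?M"
    proof -
      \<comment> \<open>By \<open>ker_subset\<close> T* vanishes on ker T, so the range of T is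
        orthogonal to ker T.\<close>
      have "cinner (T y) z = 0" if "T z = 0" for y z
        using ker_subset[OF that] by (simp add: cinner.zero_right flip: cinner_cadjoint_right[OF T])
      then show ?thesis
        using D_T by (auto simp: orth_compl_def)
    qed
    show "y = 0" if "y \<in> ?M" "T y = 0" for y
      using that orth_compl_inter[of y ?N] by simp
  qed
  have N: "csubspace ?N" "closed ?N"
    by (rule csubspace_ker[OF T], rule closed_ker[OF T])
  obtain q where q: "T q = 0" "x - q \<in> orth_compl ?N"
    using exists_orth_decomposition[OF N, of x] by auto
  have q': "cadjoint T q = 0"
    by (rule ker_subset[OF q(1)])
  \<comment> \<open>The kernel of T lies in \<open>D\<close>: for z in \<open>K\<close>, <q, z> =
    <q, T*T z> = <T*T q, z> = 0.\<close>
  have "q \<in> D"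
  proof -
    have "cinner q z = 0" if z: "z \<in> K" for z
    proof -
      have "cinner q z = cinner (cadjoint T (T q)) z"
        using z by (simp add: K_def cinner_cadjoint_left[OF T] flip: cinner_cadjoint_right[OF T])
      then show ?thesis
        by (simp add: q(1) bounded_clinearD(4)[OF T'] cinner.zero_left)
    qed
    then show ?thesis
      by (simp add: D_eq orth_compl_def)
  qed
  then have "x - q \<in> ?M"
    using q(2) csubspaceD(4)[OF csubspace_D x] by simp
  then obtain p where p: "x - q = T p"
    using TM by (metis imageE)
  then have "x = T p + q"
    by (simp add: algebra_simps)
  then show ?thesis
    by (simp add: bounded_clinearD[OF T] bounded_clinearD[OF T'] q q' TTT)
qed

section \<open>Wold decomposition of the isometric part\<close>

lemma isometry_ker_adjoint_reducing_zero:
  assumes cnu: "completely_non_unitary T"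
    and M: "csubspace M" "closed M" and MK: "M \<subseteq> K"
    and TM: "T ` M \<subseteq> M" and T'M: "cadjoint T ` M \<subseteq> M"
    and orth: "\<And>x. x \<in> M \<Longrightarrow> cadjoint T x = 0 \<Longrightarrow> x = 0"
  shows "M = {0}"
proof -
  have "cinner (T x) y = 0" if "x \<in> orth_compl M" "y \<in> M" for x y
    using that T'M by (auto simp: orth_compl_def simp flip: cinner_cadjoint_right[OF T])
  then have "reducing_subspace T M"
    using M TM by (auto simp: reducing_subspace_def orth_compl_def)
  moreover have "unitary_on M T"
  proof -
    \<comment> \<open>The vector x - T T* x lies in M, and T* annihilates it because T*T is the
      identity on \<open>K\<close>; by \<open>orth\<close> it is zero. Hence T maps M onto
      itself.\<close>
    have "T (cadjoint T x) = x" if x: "x \<in> M" for x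
    proof -
      have "cadjoint T x \<in> M"
        using x T'M by blast
      then have "x - T (cadjoint T x) \<in> M" and "cadjoint T (T (cadjoint T x)) = cadjoint T x"
        using x TM MK by (auto intro!: csubspaceD(4)[OF M(1)] simp: K_def)
      then have "x - T (cadjoint T x) = 0"
        by (intro orth[of "x - T (cadjoint T x)"]) (simp_all add: bounded_clinearD[OF T'])
      then show ?thesis by simp
    qed
    then have "M \<subseteq> T ` M"
      using T'M by (metis image_eqI image_subset_iff subsetI)
    then show ?thesis
      using TM MK isometric_on_K by (auto simp: unitary_on_def)
  qed
  ultimately show ?thesis
    using cnu unfolding completely_non_unitary_def by blast
qed

lemma exists_shift_basis:
  assumes cnu: "completely_non_unitary T" and k: "k \<ge> 1"
    and d: "orthonormal_on {1..n} d" "cspan (d ` {1..n}) = D"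
    and l: "orthonormal_on {1..k} l" "cspan (l ` {1..k}) = K \<inter> {x. cadjoint T x = 0}"
  obtains e :: "nat \<Rightarrow> 'a" where "orthonormal_basis e" "\<And>m. m \<le> n \<Longrightarrow> e m = d m"
    "\<And>m. m > n \<Longrightarrow> e m \<in> K" "\<And>m. m > n \<Longrightarrow> T (e m) = e (m + k)"
proof -
  \<comment> \<open>Past the basis of \<open>D\<close>, write m - n - 1 = q k + r; the entry is T^q
    applied to the wandering vector l (r + 1). The offsets by 1 pass between remainders starting at
    0 and indices starting at 1.\<close>
  define e where "e m = (if m \<le> n then d m else (T ^^ ((m - n - 1) div k)) (l ((m - n - 1) mod k + 1)))" for m
  have e_d: "e m = d m" if "m \<le> n" for m
    using that by (simp add: e_def)
  have e_l: "e m = l (m - n)" if "m > n" "m \<le> n + k" for m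
    using that k by (simp add: e_def Suc_diff_Suc)
  have Te: "T (e m) = e (m + k)" if "m > n" for m
  proof -
    have "(m + k - n - 1) div k = Suc ((m - n - 1) div k)"
      and "(m + k - n - 1) mod k = (m - n - 1) mod k"
      using that k div_add_self2[of k "m - n - 1"] mod_add_self2[of "m - n - 1" k] by simp_all
    then show ?thesis
      using that by (simp add: e_def)
  qed
  have e_l_mem: "e m \<in> K \<and> cadjoint T (e m) = 0" if "m > n" "m \<le> n + k" for m
  proof -
    have "m - n \<in> {1..k}" using that by auto
    then have "e m \<in> cspan (l ` {1..k})"
      unfolding e_l[OF that] by (intro complex_vector.span_base imageI)
    then show ?thesis
      unfolding l(2) by simp
  qed
  have e_shift: "e m = T (e (m - k))" if "m > n + k" for m
    using Te[of "m - k"] that by simp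
  have eK: "e m \<in> K" if "m > n" for m
    using that
  proof (induction m rule: less_induct)
    case (less m)
    show ?case
    proof (cases "m \<le> n + k")
      case True
      with less.prems show ?thesis by (simp add: e_l_mem)
    next
      case False
      then show ?thesis
        using less.IH[of "m - k"] k by (simp add: e_shift K_T)
    qed
  qed
  have eD: "e m \<in> D" if "1 \<le> m" "m \<le> n" for m
    using that e_d d(2) complex_vector.span_base[of "d m" "d ` {1..n}"] by auto
  \<comment> \<open>On this part of the family T* is the backward shift by k, killing the first
    block.\<close>
  have T'e: "cadjoint T (e m) = (if m \<le> n + k then 0 else e (m - k))" if "m > n" for m
    using that eK[of "m - k"] by (auto simp: e_l_mem e_shift K_def)
  \<comment> \<open>Moving T across the inner product lowers both indices by k, until one of them is
    in the first block, where T* gives zero or both vectors come from \<open>l\<close>.\<close>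
  have ip: "cinner (e i) (e j) = (if i = j then 1 else 0)" if "i > n" "j > n" for i j
    using that
  proof (induction i arbitrary: j rule: less_induct)
    case (less i)
    show ?case
    proof (cases "i \<le> n + k")
      case i: True
      show ?thesis
      proof (cases "j \<le> n + k")
        case True
        have "i - n \<in> {1..k}" "j - n \<in> {1..k}" "i - n = j - n \<longleftrightarrow> i = j"
          using i True less.prems by auto
        with l(1) have "cinner (l (i - n)) (l (j - n)) = (if i = j then 1 else 0)"
          by (simp add: orthonormal_on_def)
        then show ?thesis
          using i True less.prems by (simp add: e_l)
      next
        case False
        then have "cinner (e i) (e j) = cinner (cadjoint T (e i)) (e (j - k))"
          by (simp add: e_shift[of j] cinner_cadjoint_left[OF T])
        also have "\<dots> = 0"
          using i less.prems by (simp add: T'e cinner.zero_left)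
        finally show ?thesis
          using i False by auto
      qed
    next
      case False
      then have "cinner (e i) (e j) = cinner (e (i - k)) (cadjoint T (e j))"
        by (simp add: e_shift[of i] cinner_cadjoint_right[OF T])
      also have "\<dots> = (if i = j then 1 else 0)"
        using False less.prems less.IH[of "i - k" "j - k"] k by (auto simp: T'e cinner.zero_right)
      finally show ?thesis .
    qed
  qed
  have orthonormal: "cinner (e i) (e j) = (if i = j then 1 else 0)" if ij: "i \<ge> 1" "j \<ge> 1" for i j
  proof (cases "i \<le> n")
    case i: True
    show ?thesis
    proof (cases "j \<le> n")
      case True
      then show ?thesis
        using i ij d(1) by (simp add: e_d orthonormal_on_def)
    next
      case False
      then show ?thesis
        using i ij cinner_D_K[OF eD[of i] eK[of j]] by auto
    qed
  next
    case i: False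
    show ?thesis
    proof (cases "j \<le> n")
      case True
      then show ?thesis
        using i ij cinner_D_K[OF eD[of j] eK[of i]] cinner_eq_0_commute[of "e i" "e j"] by auto
    next
      case False
      then show ?thesis
        using i ip by simp
    qed
  qed
  \<comment> \<open>The vectors that the family misses. They form a subspace of \<open>K\<close>
    invariant under T and T*, with T* injective on it, which complete non-unitarity forces to be
    zero.\<close>
  let ?M = "orth_compl (e ` {1..})"
  have memI: "x \<in> ?M" if "\<And>m. m \<ge> 1 \<Longrightarrow> cinner x (e m) = 0" for x
    using that by (auto simp: orth_compl_def)
  have memD: "cinner x (e m) = 0" if "x \<in> ?M" "m \<ge> 1" for x m
    using that by (auto simp: orth_compl_def)
  have MK: "?M \<subseteq> K"
  proof
    fix x assume x: "x \<in> ?M"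
    have "d ` {1..n} \<subseteq> e ` {1..}"
      using e_d by (auto simp: image_iff) (metis atLeast_iff)
    then have "x \<in> orth_compl (d ` {1..n})"
      using x by (auto simp: orth_compl_def)
    then show "x \<in> K"
      unfolding orth_compl_cspan[of "d ` {1..n}", symmetric] d(2) orth_compl_D .
  qed
  have "?M = {0}"
  proof (rule isometry_ker_adjoint_reducing_zero[OF cnu csubspace_orth_compl closed_orth_compl MK])
    show "T ` ?M \<subseteq> ?M"
    proof clarify
      fix x assume x: "x \<in> ?M"
      show "T x \<in> ?M"
      proof (rule memI)
        fix m :: nat assume m: "m \<ge> 1"
        \<comment> \<open>Up to n this is orthogonality of \<open>K\<close> and \<open>D\<close>;
          beyond n, T* sends e m to zero or back into the family.\<close>
        show "cinner (T x) (e m) = 0"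
        proof (cases "m \<le> n")
          case True
          then show ?thesis
            using cinner_D_K[OF eD[OF m True] K_T] x MK cinner_eq_0_commute[of "T x"] by blast
        next
          case False
          then show ?thesis
            using memD[OF x, of "m - k"] m
            by (simp add: T'e cinner.zero_right flip: cinner_cadjoint_right[OF T])
        qed
      qed
    qed
    show "cadjoint T ` ?M \<subseteq> ?M"
    proof clarify
      fix x assume x: "x \<in> ?M"
      show "cadjoint T x \<in> ?M"
      proof (rule memI)
        fix m :: nat assume m: "m \<ge> 1"
        show "cinner (cadjoint T x) (e m) = 0"
        proof (cases "m \<le> n")
          case True
          then show ?thesis
            using cinner_D_K[OF eD[OF m True] K_T'] x MK cinner_eq_0_commute[of "cadjoint T x"] by blast
        next
          case False
          then show ?thesis
            using memD[OF x, of "m + k"] m by (simp add: cinner_cadjoint_left[OF T] Te)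
        qed
      qed
    qed
    show "x = 0" if x: "x \<in> ?M" "cadjoint T x = 0" for x
    proof (rule orth_compl_inter)
      show "x \<in> cspan (l ` {1..k})"
        using l(2) x MK by auto
      have "l i = e (n + i)" if "i \<in> {1..k}" for i
        using that e_l[of "n + i"] by simp
      then have "x \<in> orth_compl (l ` {1..k})"
        using x(1) by (auto simp: orth_compl_def)
      then show "x \<in> orth_compl (cspan (l ` {1..k}))"
        by (simp add: orth_compl_cspan)
    qed
  qed
  then have "orthonormal_basis e"
    using orthonormal by (simp add: orthonormal_basis_def closure_cspan_eq_UNIV)
  with e_d eK Te that show ?thesis
    by blast
qed

end

section \<open>Passage between quasinormality and the shift form\<close>

theorem theorem2p6:
  fixes T F\<^sub>1 :: "'a::chilbert_space \<Rightarrow> 'a" and k n :: nat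
  assumes separable: "separable_space (euclidean :: 'a topology)"
    and infinite_dimensional: "\<not> (\<exists>B :: 'a set. finite B \<and> cspan B = UNIV)"
    and "k \<ge> 1" and "n \<ge> 1"
    and "contraction T" and "completely_non_unitary T"
    and "cdim (defect_space T) = n"
    and "cdim (defect_space (cadjoint T) \<inter> orth_compl (defect_space T)) = k"
    and "bounded_clinear F\<^sub>1"
    and "\<And>x. x \<in> defect_space T \<Longrightarrow> F\<^sub>1 x = T x"
    and "\<And>x. x \<in> orth_compl (defect_space T) \<Longrightarrow> F\<^sub>1 x = 0"
  shows "quasinormal T \<longleftrightarrow>
    (\<exists>(e :: nat \<Rightarrow> 'a) S P F.
        orthonormal_basis e \<and>
        bounded_clinear S \<and> (\<forall>m\<ge>1. S (e m) = e (m + k)) \<and>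
        P = orth_proj (cspan (e ` {1..n})) \<and>
        F = (\<lambda>x. F\<^sub>1 x - S (P x)) \<and>
        T = (\<lambda>x. S x + F x) \<and>
        op_rank (\<lambda>x. P x - cadjoint F\<^sub>1 (F\<^sub>1 x)) = n \<and>
        (\<forall>x. F\<^sub>1 (x - P x) = 0) \<and> (\<forall>x. F\<^sub>1 x - P (F\<^sub>1 x) = 0) \<and>
        (\<forall>x. norm (cadjoint F\<^sub>1 x) = norm (F\<^sub>1 x)) \<and>
        (\<forall>r\<ge>1. \<forall>x. P x \<noteq> 0 \<longrightarrow> norm ((F\<^sub>1 ^^ r) x) < norm (P x)))"
proof
  assume qn: "quasinormal T"
  interpret quasinormal_contraction T
    by unfold_locales fact+
  have F: "F\<^sub>1 x = T x" if "x \<in> D" for x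
    using that by fact
  have F0: "F\<^sub>1 x = 0" if "x \<in> K" for x
    using that unfolding orth_compl_D[symmetric] by fact
  obtain d :: "nat \<Rightarrow> 'a" where d: "orthonormal_on {1..n} d" "cspan (d ` {1..n}) = D"
    using exists_orthonormal_basis_of_subspace[OF csubspace_D \<open>cdim D = n\<close> \<open>n \<ge> 1\<close>] .
  have L: "csubspace (K \<inter> {x. cadjoint T x = 0})"
    by (intro complex_vector.subspace_inter csubspace_K csubspace_ker T')
  have "cdim (K \<inter> {x. cadjoint T x = 0}) = k"
    unfolding wandering_subspace_eq[symmetric] by fact
  then obtain l :: "nat \<Rightarrow> 'a" where l: "orthonormal_on {1..k} l"
      "cspan (l ` {1..k}) = K \<inter> {x. cadjoint T x = 0}"
    using exists_orthonormal_basis_of_subspace[OF L _ \<open>k \<ge> 1\<close>] by blast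
  obtain e where e: "orthonormal_basis e" and ed: "\<And>m. m \<le> n \<Longrightarrow> e m = d m"
    and eK: "\<And>m. m > n \<Longrightarrow> e m \<in> K" and Te: "\<And>m. m > n \<Longrightarrow> T (e m) = e (m + k)"
    by (rule exists_shift_basis[OF \<open>completely_non_unitary T\<close> \<open>k \<ge> 1\<close> d l]) blast
  have on: "orthonormal_on {1..n} e"
    using e by (rule orthonormal_basis_on) auto
  have "e ` {1..n} = d ` {1..n}"
    by (rule image_cong) (simp_all add: ed)
  then have span_e: "cspan (e ` {1..n}) = D"
    using d(2) by simp
  define P where "P = orth_proj (cspan (e ` {1..n}))"
  have P: "P x = (\<Sum>i\<in>{1..n}. cinner x (e i) *\<^sub>C e i)" for x
    unfolding P_def by (rule orth_proj_orthonormal[OF on]) simp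
  have Pb: "bounded_clinear P"
    unfolding P[THEN ext] by (intro bounded_clinear_sum bounded_clinear_rank_one)
  have PD: "P x \<in> D" for x
    unfolding P span_e[symmetric] by (rule orthonormal_sum_in_span)
  have QK: "x - P x \<in> K" for x
    using orthonormal_residual[OF on, of x] unfolding P span_e orth_compl_D by simp
  have P_id: "P x = x" if "x \<in> D" for x
    unfolding P_def span_e
    using that by (intro orth_proj_eqI csubspace_D) (simp_all add: csubspaceD(1)[OF csubspace_orth_compl])
  have P_0: "P x = 0" if "x \<in> K" for x
    unfolding P_def span_e
    using that by (intro orth_proj_eqI csubspace_D) (simp_all add: csubspaceD(1)[OF csubspace_D] orth_compl_D)
  have P_sym: "cinner (P x) y = cinner x (P y)" for x y
    unfolding P cinner.sum_left cinner.sum_right cinner_scaleC_left cinner_scaleC_right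
    by (rule sum.cong) (simp_all add: mult.commute flip: cinner_commute)
  \<comment> \<open>Thus \<open>F\<^sub>1\<close> is T P, and its adjoint is P T*; all four
    conditions are checked in this form.\<close>
  have F_eq: "F\<^sub>1 x = T (P x)" for x
    using bounded_clinearD(3)[OF \<open>bounded_clinear F\<^sub>1\<close>, of x "P x"] F[OF PD[of x]] F0[OF QK[of x]] by simp
  have FD: "F\<^sub>1 x \<in> D" for x
    unfolding F_eq by (intro D_T PD)
  have adj: "cadjoint F\<^sub>1 y = P (cadjoint T y)" for y
    by (rule cadjoint_eqI[OF \<open>bounded_clinear F\<^sub>1\<close>])
      (simp add: F_eq cinner_cadjoint_right[OF T] flip: P_sym)
  \<comment> \<open>On \<open>K\<close> the operator T already shifts the basis. On \<open>D\<close>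
    it need not, so there the shift is imposed by an explicit finite-rank sum.\<close>
  define S where "S x = T (x - P x) + (\<Sum>i\<in>{1..n}. cinner x (e i) *\<^sub>C e (i + k))" for x
  have Sb: "bounded_clinear S"
    unfolding S_def
    by (intro bounded_clinear_add bounded_clinear_compose[OF T] bounded_clinear_diff
        bounded_clinear_ident Pb bounded_clinear_sum bounded_clinear_rank_one)
  have ip: "cinner (e i) (e j) = (if i = j then 1 else 0)" if "i \<ge> 1" "j \<ge> 1" for i j
    using e that by (simp add: orthonormal_basis_def)
  have sum_e: "(\<Sum>i\<in>{1..n}. cinner (e m) (e i) *\<^sub>C e (i + k)) = (if m \<le> n then e (m + k) else 0)"
    if "m \<ge> 1" for m
  proof -
    have "(\<Sum>i\<in>{1..n}. cinner (e m) (e i) *\<^sub>C e (i + k)) = (\<Sum>i\<in>{1..n}. if i = m then e (m + k) else 0)"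
      by (rule sum.cong) (use that in \<open>auto simp: ip scaleC_one\<close>)
    then show ?thesis
      using that by simp
  qed
  have Se: "S (e m) = e (m + k)" if m: "m \<ge> 1" for m
  proof (cases "m \<le> n")
    case True
    then have "e m \<in> D"
      unfolding span_e[symmetric] using m by (intro complex_vector.span_base imageI) simp
    with True sum_e[OF m] show ?thesis
      by (simp add: S_def P_id bounded_clinearD(4)[OF T])
  next
    case False
    with sum_e[OF m] show ?thesis
      by (simp add: S_def P_0 eK Te)
  qed
  \<comment> \<open>The imposed part of \<open>S\<close> lives on \<open>D\<close>, so subtracting S
    P removes it and leaves T on \<open>K\<close>.\<close>
  have SP: "S x - S (P x) = T (x - P x)" for x
  proof -
    have "cinner (x - P x) (e i) = 0" if "i \<in> {1..n}" for i
    proof -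
      have "e i \<in> D"
        unfolding span_e[symmetric] using that by (intro complex_vector.span_base imageI)
      then show ?thesis
        using cinner_D_K[of "e i" "x - P x"] QK[of x] cinner_eq_0_commute[of "x - P x" "e i"] by simp
    qed
    then have "(\<Sum>i\<in>{1..n}. cinner (x - P x) (e i) *\<^sub>C e (i + k)) = 0"
      by (intro sum.neutral) simp
    moreover have "S x - S (P x) = S (x - P x)"
      by (simp add: bounded_clinearD(3)[OF Sb])
    ultimately show ?thesis
      by (simp add: S_def P_0[OF QK])
  qed
  have T_eq: "T x = S x + (F\<^sub>1 x - S (P x))" for x
    using SP[of x] by (simp add: F_eq bounded_clinearD(3)[OF T] algebra_simps)
  have fin: "finite (e ` {1..n})" "D \<subseteq> cspan (e ` {1..n})"
    unfolding span_e by simp_all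
  \<comment> \<open>The operator equals (I - T*T) P. On \<open>D\<close> the defect operator is
    injective, since its kernel is \<open>K\<close>, hence onto by finite dimension; so the range is
    \<open>D\<close> itself.\<close>
  have rank: "op_rank (\<lambda>x. P x - cadjoint F\<^sub>1 (F\<^sub>1 x)) = n"
  proof -
    let ?A = "\<lambda>x. x - cadjoint T (T x)"
    have "P x - cadjoint F\<^sub>1 (F\<^sub>1 x) = ?A (P x)" for x
      unfolding adj F_eq by (simp add: P_id D_T D_T' PD)
    then have "range (\<lambda>x. P x - cadjoint F\<^sub>1 (F\<^sub>1 x)) = ?A ` range P"
      by (simp only: image_image)
    also have "range P = D"
      using PD P_id by (metis image_eqI image_subset_iff subset_antisym subsetI UNIV_I)
    also have "?A ` D = D"
    proof (rule injective_imp_surjective_subspace[OF bounded_clinear_defect csubspace_D fin])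
      show "?A ` D \<subseteq> D"
        by (auto intro!: csubspaceD(4)[OF csubspace_D] D_T D_T')
      show "x = 0" if "x \<in> D" "?A x = 0" for x
        using that D_K_zero[of x] by (simp add: K_def)
    qed
    finally show ?thesis
      using \<open>cdim D = n\<close> by (simp add: op_rank_def)
  qed
  \<comment> \<open>Both sides depend only on P x: T* keeps x - P x in \<open>K\<close>, where P is
    zero. The claim becomes normality of T on \<open>D\<close>.\<close>
  have normal: "norm (cadjoint F\<^sub>1 x) = norm (F\<^sub>1 x)" for x
  proof -
    have "cadjoint T x = cadjoint T (P x) + cadjoint T (x - P x)"
      by (simp flip: bounded_clinearD(2)[OF T'])
    then have "cadjoint F\<^sub>1 x = cadjoint T (P x)"
      unfolding adj by (simp add: bounded_clinearD(2)[OF Pb] P_id[OF D_T'[OF PD]] P_0[OF K_T'[OF QK]])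
    moreover have "cinner (cadjoint T (P x)) (cadjoint T (P x)) = cinner (T (P x)) (T (P x))"
      unfolding cinner_cadjoint_right[OF T] normal_on_D[OF fin PD]
      by (rule cinner_cadjoint_left[OF T])
    then have "(norm (cadjoint T (P x)))\<^sup>2 = (norm (T (P x)))\<^sup>2"
      by (simp only: cinner_self of_real_eq_iff)
    ultimately show ?thesis
      by (simp add: F_eq power2_eq_iff_nonneg)
  qed
  \<comment> \<open>The first application decreases the norm strictly, as P x is a nonzero vector of
    \<open>D\<close>. Every power stays in \<open>D\<close>, where \<open>F\<^sub>1\<close> agrees
    with the contraction T, so later ones cannot increase it.\<close>
  have powers: "norm ((F\<^sub>1 ^^ r) x) < norm (P x)" if "r \<ge> 1" "P x \<noteq> 0" for r x
    using that(1)
  proof (induction r rule: dec_induct)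
    case base
    show ?case
      using strict_contraction_on_D[OF PD that(2)] by (simp add: F_eq)
  next
    case (step r)
    obtain s where "r = Suc s"
      using step.hyps(1) by (cases r) auto
    then have "(F\<^sub>1 ^^ r) x \<in> D"
      using FD by simp
    then have "norm ((F\<^sub>1 ^^ Suc r) x) \<le> norm ((F\<^sub>1 ^^ r) x)"
      using contraction by (simp add: F contraction_def)
    with step.IH show ?case by simp
  qed
  show "\<exists>(e :: nat \<Rightarrow> 'a) S P F.
        orthonormal_basis e \<and>
        bounded_clinear S \<and> (\<forall>m\<ge>1. S (e m) = e (m + k)) \<and>
        P = orth_proj (cspan (e ` {1..n})) \<and>
        F = (\<lambda>x. F\<^sub>1 x - S (P x)) \<and>
        T = (\<lambda>x. S x + F x) \<and>
        op_rank (\<lambda>x. P x - cadjoint F\<^sub>1 (F\<^sub>1 x)) = n \<and>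
        (\<forall>x. F\<^sub>1 (x - P x) = 0) \<and> (\<forall>x. F\<^sub>1 x - P (F\<^sub>1 x) = 0) \<and>
        (\<forall>x. norm (cadjoint F\<^sub>1 x) = norm (F\<^sub>1 x)) \<and>
        (\<forall>r\<ge>1. \<forall>x. P x \<noteq> 0 \<longrightarrow> norm ((F\<^sub>1 ^^ r) x) < norm (P x))"
    by (intro exI[of _ e] exI[of _ S] exI[of _ P] exI[of _ "\<lambda>x. F\<^sub>1 x - S (P x)"] conjI allI impI)
      (fact e Sb Se P_def refl T_eq[THEN ext] rank normal powers | simp add: F0 QK P_id FD)+
next
  assume "\<exists>(e :: nat \<Rightarrow> 'a) S P F.
        orthonormal_basis e \<and>
        bounded_clinear S \<and> (\<forall>m\<ge>1. S (e m) = e (m + k)) \<and>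
        P = orth_proj (cspan (e ` {1..n})) \<and>
        F = (\<lambda>x. F\<^sub>1 x - S (P x)) \<and>
        T = (\<lambda>x. S x + F x) \<and>
        op_rank (\<lambda>x. P x - cadjoint F\<^sub>1 (F\<^sub>1 x)) = n \<and>
        (\<forall>x. F\<^sub>1 (x - P x) = 0) \<and> (\<forall>x. F\<^sub>1 x - P (F\<^sub>1 x) = 0) \<and>
        (\<forall>x. norm (cadjoint F\<^sub>1 x) = norm (F\<^sub>1 x)) \<and>
        (\<forall>r\<ge>1. \<forall>x. P x \<noteq> 0 \<longrightarrow> norm ((F\<^sub>1 ^^ r) x) < norm (P x))"
  then obtain e S P where e: "orthonormal_basis e" and S: "bounded_clinear S"
    and Se: "\<forall>m\<ge>1. S (e m) = e (m + k)" and P: "P = orth_proj (cspan (e ` {1..n}))"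
    and T_eq: "T = (\<lambda>x. S x + (F\<^sub>1 x - S (P x)))"
    and FP: "\<forall>x. F\<^sub>1 (x - P x) = 0" and PF: "\<forall>x. F\<^sub>1 x - P (F\<^sub>1 x) = 0"
    and norm: "\<forall>x. norm (cadjoint F\<^sub>1 x) = norm (F\<^sub>1 x)"
    by (elim exE conjE) simp
  show "quasinormal T"
  proof (rule quasinormal_block_form[OF _ \<open>bounded_clinear F\<^sub>1\<close> e S _ P])
    show "bounded_clinear T"
      using \<open>contraction T\<close> by (simp add: contraction_def)
    \<comment> \<open>The two occurrences of S in S + (\<open>F\<^sub>1\<close> - S P) combine into
      S (I - P), which yields the block form.\<close>
    show "T x = S (x - P x) + F\<^sub>1 x" for x
      by (subst T_eq) (simp add: bounded_clinearD(3)[OF S])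
    show "F\<^sub>1 (P x) = F\<^sub>1 x" for x
      using FP by (simp add: bounded_clinearD(3)[OF \<open>bounded_clinear F\<^sub>1\<close>])
  qed (use Se PF norm in auto)
qed

end
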